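(* Let $\Upsilon$ be a gain signed graph and $S\subseteq E$. Then $M(\Upsilon\setminus S)=M(\Upsilon)\setminus S$ and $M(\Upsilon/S)=M(\Upsilon)/S$, where on the right the operations are matroid deletion and contraction.
   Context: Let $\mathbb{K}$ be a field of characteristic $\ne2$. A graph $\Gamma=(V,E)$ has vertex set $V=\{v_1,\dots,v_n\}$ and finite edge set $E$; edges are links (two ends at distinct vertices), loops (two ends at one vertex), half edges (one end) or loose edges (no ends); parallel edges allowed. A gain signed graph $\Upsilon=(\Gamma,\sigma,\varphi)$: $\sigma:E\to\{\pm1\}$ (half edges negative, loose edges positive); with an orientation $\tau$ (signs $\tau(v,e)\in\{\pm1\}$ on edge ends, $\tau(v,e)\tau(w,e)=-\sigma(e)$ for a link or loop with ends $v,w$) each edge has gain $\varphi(e)\in\mathbb{K}$, negated on reorientation. Neutral = gain $0$. Walk gain of $W=u_0e_1\cdots e_lu_l$: $\varphi(W)=-\sum_i\varphi(e_i)\sigma(W_{0,i-1})\tau(u_{i-1},e_i)$, $\sigma(W_{0,j})=\prod_{i\le j}\sigma(e_i)$. Ultrawalks may begin with a half edge $e_0$ at $u_0$ and/or end with a half edge $e_{l+1}$ at $u_l$; their gain adds $\tau(u_0,e_0)\varphi(e_0)$ and/or $-\varphi(e_{l+1})\sigma(W_{0,l})\tau(u_l,e_{l+1})$ to $\varphi(W_{0,l})$. Circles: connected 2-regular subgraphs, sign = product of edge signs; a negative figure is a negative circle or a half edge. A sign circuit is a positive circle, a loose edge, or a handcuff (two negative figures with exactly one common vertex, or two disjoint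 negative figures plus a path joining them meeting them only at its ends). Its gain: the edge gain for a loose edge; else $\varphi(W)$ for a circuit walk (once around a positive circle; for a handcuff with figures $C_1,C_2$, connecting path $P$ of length $\ge0$: around $C_1$, along $P$, around $C_2$, back along $P$ if both circles; from half edge $C_1$ along $P$, around $C_2$, back, ending with $C_1$ if $C_1$ half edge and $C_2$ circle; from one half edge along $P$ to the other if both half edges); well defined up to sign; neutral if $0$. $S$ is hyperbalanced if all sign circuits in $S$ are neutral, hyperfrustrated otherwise; sign balanced if no negative circle and no half edge. $b_\Sigma(S)$ = number of sign-balanced connected components of $(V,S)$ (loose edges excluded); $\pi_b(S)$ = their vertex sets. $M(\Upsilon)$: the matroid on $E$ with rank $|V|-b_\Sigma(S)+\delta(S)$, $\delta=0$ if $S$ hyperbalanced and $1$ otherwise (for a gain signed graph on any vertex set). Switching: sign switcher $\zeta:V\to\{\pm1\}$ changes $\sigma(e)$ to $\zeta(v)\sigma(e)\zeta(w)$ for a link/loop with ends $v,w$ and $\tau(v,e)$ to $\zeta(v)\tau(v,e)$; gain switcher $\theta:V\to\mathbb{K}$ changes $\varphi(e)$ to $\tau(v,e)\theta(v)+\varphi(e)+\tau(w,e)\theta(w)$ (link/loop), $\tau(v,e)\theta(v)+\varphi(e)$ (half edge at $v$), loose edges unchanged. Deletion $\Upsilon\setminus S$: restriction to $E\setminus S$ on the same vertices. Contraction: for $v\in V$ let $B_v$ be the block of $\pi_b(S)$ containing $v$, if any. The signed contraction $\Sigma/S$: switch signs so all edges of sign-balanced components of $S$ are positive; vertex set $\pi_b(S)$,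 edge set $E\setminus S$; a link or loop with ends $v,w$ gets ends at those of $B_v,B_w$ that exist, keeping its switched sign if both exist, becoming a negative half edge if exactly one exists and a positive loose edge if none; a half edge at $v$ becomes a half edge at $B_v$ if it exists, else a loose edge; loose edges stay loose; surviving ends keep their switched orientation. If $S$ is hyperbalanced, $\Upsilon/S$ is formed by first gain-switching so every edge of $S$ is neutral, then forming $\Sigma/S$ with edges of $E\setminus S$ keeping their switched gains. If $S$ is hyperfrustrated, $\Upsilon/S$ is $\Sigma/S$ with all gains $0$. *)

theory Defs
  imports Complex_Main "HOL-Library.FuncSet"
begin

section \<open>Gain signed graphs\<close>

text \<open>
  The incidences of an edge are listed in \<open>ends\<close>: one entry per edge end, consisting of the vertex
  and the orientation sign \<open>\<tau>\<close> of that end. So a link or loop has two entries (a loop carries one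
  sign for each of its two ends), a half edge has one, a loose edge none. The order of the
  two entries is immaterial. The gain of an edge is the one with respect to the
  recorded orientation.
\<close>

record ('v, 'e, 'k) gain_signed_graph =
  verts :: "'v set"
  edges :: "'e set"
  ends :: "'e \<Rightarrow> ('v \<times> int) list"
  esign :: "'e \<Rightarrow> int"
  gain :: "'e \<Rightarrow> 'k"

definition link_or_loop :: "('v, 'e, 'k) gain_signed_graph \<Rightarrow> 'e \<Rightarrow> bool" where
  "link_or_loop G e \<longleftrightarrow> e \<in> edges G \<and> length (ends G e) = 2"

definition half_edge :: "('v, 'e, 'k) gain_signed_graph \<Rightarrow> 'e \<Rightarrow> bool" where
  "half_edge G e \<longleftrightarrow> e \<in> edges G \<and> length (ends G e) = 1"

definition loose_edge :: "('v, 'e, 'k) gain_signed_graph \<Rightarrow> 'e \<Rightarrow> bool" where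
  "loose_edge G e \<longleftrightarrow> e \<in> edges G \<and> ends G e = []"

definition is_gain_signed_graph :: "('v, 'e, 'k) gain_signed_graph \<Rightarrow> bool" where
  "is_gain_signed_graph G \<longleftrightarrow>
     finite (verts G) \<and> finite (edges G) \<and>
     (\<forall>e \<in> edges G. link_or_loop G e \<or> half_edge G e \<or> loose_edge G e) \<and>
     (\<forall>e \<in> edges G. \<forall>(v, t) \<in> set (ends G e). v \<in> verts G \<and> t \<in> {1, -1}) \<and>
     (\<forall>e \<in> edges G. esign G e \<in> {1, -1}) \<and>
     (\<forall>e. link_or_loop G e \<longrightarrow> snd (ends G e ! 0) * snd (ends G e ! 1) = - esign G e) \<and>
     (\<forall>e. half_edge G e \<longrightarrow> esign G e = -1) \<and>
     (\<forall>e. loose_edge G e \<longrightarrow> esign G e = 1)"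

section \<open>Walks and their gains\<close>

text \<open>
  A step \<open>(e, i)\<close> of a walk traverses the link or loop \<open>e\<close> from its end number \<open>i\<close> to its other
  end; naming the end rather than the vertex gives \<open>\<tau>(u\<^sub>i\<^sub>-\<^sub>1, e\<^sub>i)\<close> a meaning also for loops.
\<close>

definition is_step :: "('v, 'e, 'k) gain_signed_graph \<Rightarrow> 'e \<times> nat \<Rightarrow> bool" where
  "is_step G d \<longleftrightarrow> link_or_loop G (fst d) \<and> snd d < 2"

definition tail :: "('v, 'e, 'k) gain_signed_graph \<Rightarrow> 'e \<times> nat \<Rightarrow> 'v" where
  "tail G d = fst (ends G (fst d) ! snd d)"

definition tail_sign :: "('v, 'e, 'k) gain_signed_graph \<Rightarrow> 'e \<times> nat \<Rightarrow> int" where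
  "tail_sign G d = snd (ends G (fst d) ! snd d)"

definition head :: "('v, 'e, 'k) gain_signed_graph \<Rightarrow> 'e \<times> nat \<Rightarrow> 'v" where
  "head G d = fst (ends G (fst d) ! (1 - snd d))"

fun walk :: "('v, 'e, 'k) gain_signed_graph \<Rightarrow> 'v \<Rightarrow> ('e \<times> nat) list \<Rightarrow> 'v \<Rightarrow> bool" where
  "walk G u [] w \<longleftrightarrow> u \<in> verts G \<and> u = w"
| "walk G u (d # W) w \<longleftrightarrow> is_step G d \<and> tail G d = u \<and> walk G (head G d) W w"

definition walk_edges :: "('e \<times> nat) list \<Rightarrow> 'e set" where
  "walk_edges W = fst ` set W"

definition walk_verts :: "('v, 'e, 'k) gain_signed_graph \<Rightarrow> 'v \<Rightarrow> ('e \<times> nat) list \<Rightarrow> 'v list" where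
  "walk_verts G u W = u # map (head G) W"

definition walk_back :: "('e \<times> nat) list \<Rightarrow> ('e \<times> nat) list" where
  "walk_back W = rev (map (\<lambda>(e, i). (e, 1 - i)) W)"

definition walk_sign :: "('v, 'e, 'k) gain_signed_graph \<Rightarrow> ('e \<times> nat) list \<Rightarrow> int" where
  "walk_sign G W = (\<Prod>d \<leftarrow> W. esign G (fst d))"

definition walk_gain :: "('v, 'e, 'k::field) gain_signed_graph \<Rightarrow> ('e \<times> nat) list \<Rightarrow> 'k" where
  "walk_gain G W =
     - (\<Sum>i<length W. gain G (fst (W ! i)) * of_int (walk_sign G (take i W)) * of_int (tail_sign G (W ! i)))"

definition half_edge_orient :: "('v, 'e, 'k) gain_signed_graph \<Rightarrow> 'e \<Rightarrow> int" where
  "half_edge_orient G e = snd (ends G e ! 0)"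

text \<open>The gain of the ultrawalk with optional initial half edge \<open>a\<close> and final half edge \<open>b\<close>.\<close>

definition ultrawalk_gain ::
  "('v, 'e, 'k::field) gain_signed_graph \<Rightarrow> 'e option \<Rightarrow> ('e \<times> nat) list \<Rightarrow> 'e option \<Rightarrow> 'k" where
  "ultrawalk_gain G a W b =
     (case a of None \<Rightarrow> 0 | Some e \<Rightarrow> of_int (half_edge_orient G e) * gain G e)
     + walk_gain G W
     + (case b of None \<Rightarrow> 0 | Some e \<Rightarrow>
          - (gain G e * of_int (walk_sign G W) * of_int (half_edge_orient G e)))"

section \<open>Circles, sign circuits and balance\<close>

definition vertex_set :: "('v, 'e, 'k) gain_signed_graph \<Rightarrow> 'e set \<Rightarrow> 'v set" where
  "vertex_set G C = (\<Union>e\<in>C. fst ` set (ends G e))"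

definition degree_in :: "('v, 'e, 'k) gain_signed_graph \<Rightarrow> 'e set \<Rightarrow> 'v \<Rightarrow> nat" where
  "degree_in G C v = (\<Sum>e\<in>C. length (filter (\<lambda>p. fst p = v) (ends G e)))"

definition connected_by :: "('v, 'e, 'k) gain_signed_graph \<Rightarrow> 'e set \<Rightarrow> 'v \<Rightarrow> 'v \<Rightarrow> bool" where
  "connected_by G S u w \<longleftrightarrow> (\<exists>W. walk G u W w \<and> walk_edges W \<subseteq> S)"

definition circle :: "('v, 'e, 'k) gain_signed_graph \<Rightarrow> 'e set \<Rightarrow> bool" where
  "circle G C \<longleftrightarrow> C \<noteq> {} \<and> (\<forall>e\<in>C. link_or_loop G e) \<and>
     (\<forall>v \<in> vertex_set G C. degree_in G C v = 2) \<and>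
     (\<forall>u \<in> vertex_set G C. \<forall>w \<in> vertex_set G C. connected_by G C u w)"

definition positive_circle :: "('v, 'e, 'k) gain_signed_graph \<Rightarrow> 'e set \<Rightarrow> bool" where
  "positive_circle G C \<longleftrightarrow> circle G C \<and> (\<Prod>e\<in>C. esign G e) = 1"

definition negative_circle :: "('v, 'e, 'k) gain_signed_graph \<Rightarrow> 'e set \<Rightarrow> bool" where
  "negative_circle G C \<longleftrightarrow> circle G C \<and> (\<Prod>e\<in>C. esign G e) = -1"

definition negative_figure :: "('v, 'e, 'k) gain_signed_graph \<Rightarrow> 'e set \<Rightarrow> bool" where
  "negative_figure G C \<longleftrightarrow> negative_circle G C \<or> (\<exists>e. half_edge G e \<and> C = {e})"

definition is_path :: "('v, 'e, 'k) gain_signed_graph \<Rightarrow> 'v \<Rightarrow> ('e \<times> nat) list \<Rightarrow> 'v \<Rightarrow> bool" where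
  "is_path G u P w \<longleftrightarrow> walk G u P w \<and> distinct (walk_verts G u P)"

text \<open>
  \<open>handcuff G C\<^sub>1 u P w C\<^sub>2\<close>: a handcuff with figures \<open>C\<^sub>1\<close>, \<open>C\<^sub>2\<close> and connecting path \<open>P\<close> from
  \<open>u\<close> to \<open>w\<close>; \<open>P = []\<close> is the case of exactly one common vertex \<open>u = w\<close>.
\<close>

definition handcuff :: "('v, 'e, 'k) gain_signed_graph \<Rightarrow> 'e set \<Rightarrow> 'v \<Rightarrow> ('e \<times> nat) list \<Rightarrow>
    'v \<Rightarrow> 'e set \<Rightarrow> bool" where
  "handcuff G C1 u P w C2 \<longleftrightarrow>
     negative_figure G C1 \<and> negative_figure G C2 \<and> C1 \<noteq> C2 \<and> is_path G u P w \<and>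
     (if P = [] then vertex_set G C1 \<inter> vertex_set G C2 = {u}
      else vertex_set G C1 \<inter> vertex_set G C2 = {} \<and>
           set (walk_verts G u P) \<inter> vertex_set G C1 = {u} \<and>
           set (walk_verts G u P) \<inter> vertex_set G C2 = {w})"

definition sign_circuit :: "('v, 'e, 'k) gain_signed_graph \<Rightarrow> 'e set \<Rightarrow> bool" where
  "sign_circuit G C \<longleftrightarrow> positive_circle G C \<or> (\<exists>e. loose_edge G e \<and> C = {e}) \<or>
     (\<exists>C1 u P w C2. handcuff G C1 u P w C2 \<and> C = C1 \<union> walk_edges P \<union> C2)"

definition once_around :: "('v, 'e, 'k) gain_signed_graph \<Rightarrow> 'e set \<Rightarrow> 'v \<Rightarrow> ('e \<times> nat) list \<Rightarrow> bool" where
  "once_around G C u W \<longleftrightarrow> walk G u W u \<and> distinct (map fst W) \<and> walk_edges W = C"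

text \<open>
  \<open>circuit_gain G C g\<close>: some circuit walk of the sign circuit \<open>C\<close> has gain \<open>g\<close> (for a loose edge,
  \<open>g\<close> is its gain). Such \<open>g\<close> is determined by \<open>C\<close> only up to sign, whence a relation.
\<close>

inductive circuit_gain :: "('v, 'e, 'k::field) gain_signed_graph \<Rightarrow> 'e set \<Rightarrow> 'k \<Rightarrow> bool" for G where
  loose: "loose_edge G e \<Longrightarrow> circuit_gain G {e} (gain G e)"
| circle: "positive_circle G C \<Longrightarrow> once_around G C u W \<Longrightarrow> circuit_gain G C (walk_gain G W)"
| circle_circle: "handcuff G C1 u P w C2 \<Longrightarrow> once_around G C1 u W1 \<Longrightarrow> once_around G C2 w W2 \<Longrightarrow>
    circuit_gain G (C1 \<union> walk_edges P \<union> C2) (walk_gain G (W1 @ P @ W2 @ walk_back P))"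
| half_circle: "handcuff G {a} u P w C2 \<Longrightarrow> half_edge G a \<Longrightarrow> once_around G C2 w W2 \<Longrightarrow>
    circuit_gain G ({a} \<union> walk_edges P \<union> C2)
      (ultrawalk_gain G (Some a) (P @ W2 @ walk_back P) (Some a))"
| half_half: "handcuff G {a} u P w {b} \<Longrightarrow> half_edge G a \<Longrightarrow> half_edge G b \<Longrightarrow>
    circuit_gain G ({a} \<union> walk_edges P \<union> {b}) (ultrawalk_gain G (Some a) P (Some b))"

definition neutral_circuit :: "('v, 'e, 'k::field) gain_signed_graph \<Rightarrow> 'e set \<Rightarrow> bool" where
  "neutral_circuit G C \<longleftrightarrow> (\<forall>g. circuit_gain G C g \<longrightarrow> g = 0)"

definition hyperbalanced :: "('v, 'e, 'k::field) gain_signed_graph \<Rightarrow> 'e set \<Rightarrow> bool" where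
  "hyperbalanced G S \<longleftrightarrow> (\<forall>C \<subseteq> S. sign_circuit G C \<longrightarrow> neutral_circuit G C)"

definition sign_balanced :: "('v, 'e, 'k) gain_signed_graph \<Rightarrow> 'e set \<Rightarrow> bool" where
  "sign_balanced G S \<longleftrightarrow> (\<forall>C \<subseteq> S. \<not> negative_circle G C) \<and> (\<forall>e \<in> S. \<not> half_edge G e)"

definition component_of :: "('v, 'e, 'k) gain_signed_graph \<Rightarrow> 'e set \<Rightarrow> 'v \<Rightarrow> 'v set" where
  "component_of G S v = {w \<in> verts G. connected_by G S v w}"

definition component_edges :: "('v, 'e, 'k) gain_signed_graph \<Rightarrow> 'e set \<Rightarrow> 'v set \<Rightarrow> 'e set" where
  "component_edges G S B = {e \<in> S. ends G e \<noteq> [] \<and> fst ` set (ends G e) \<subseteq> B}"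

text \<open>\<open>\<pi>\<^sub>b(S)\<close> and \<open>b\<^sub>\<Sigma>(S)\<close>; isolated vertices of \<open>(V, S)\<close> are sign-balanced components.\<close>

definition balanced_blocks :: "('v, 'e, 'k) gain_signed_graph \<Rightarrow> 'e set \<Rightarrow> 'v set set" where
  "balanced_blocks G S =
     {B \<in> component_of G S ` verts G. sign_balanced G (component_edges G S B)}"

definition num_balanced :: "('v, 'e, 'k) gain_signed_graph \<Rightarrow> 'e set \<Rightarrow> nat" where
  "num_balanced G S = card (balanced_blocks G S)"

section \<open>Matroids given by rank functions\<close>

text \<open>
  A matroid is presented by its ground set and its rank function, the latter restricted to the
  subsets of the ground set, so that equality of records is equality of matroids. The rank is
  integer valued so that subtraction is not truncated. The rank axioms are not part of the type.
\<close>

record 'e ranked_matroid =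
  ground :: "'e set"
  rank :: "'e set \<Rightarrow> int"

definition matroid_of_rank :: "'e set \<Rightarrow> ('e set \<Rightarrow> int) \<Rightarrow> 'e ranked_matroid" where
  "matroid_of_rank E r = \<lparr>ground = E, rank = restrict r (Pow E)\<rparr>"

definition matroid_delete :: "'e ranked_matroid \<Rightarrow> 'e set \<Rightarrow> 'e ranked_matroid" where
  "matroid_delete M S = matroid_of_rank (ground M - S) (rank M)"

definition matroid_contract :: "'e ranked_matroid \<Rightarrow> 'e set \<Rightarrow> 'e ranked_matroid" where
  "matroid_contract M S = matroid_of_rank (ground M - S) (\<lambda>A. rank M (A \<union> S) - rank M S)"

definition gain_matroid :: "('v, 'e, 'k::field) gain_signed_graph \<Rightarrow> 'e ranked_matroid" where
  "gain_matroid G = matroid_of_rank (edges G)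
     (\<lambda>S. int (card (verts G)) - int (num_balanced G S) + (if hyperbalanced G S then 0 else 1))"

section \<open>Switching, deletion and contraction\<close>

definition sign_switch ::
  "('v \<Rightarrow> int) \<Rightarrow> ('v, 'e, 'k) gain_signed_graph \<Rightarrow> ('v, 'e, 'k) gain_signed_graph" where
  "sign_switch \<zeta> G = G\<lparr>
     ends := (\<lambda>e. map (\<lambda>(v, t). (v, \<zeta> v * t)) (ends G e)),
     esign := (\<lambda>e. case ends G e of [(v, _), (w, _)] \<Rightarrow> \<zeta> v * esign G e * \<zeta> w | _ \<Rightarrow> esign G e)\<rparr>"

definition gain_switch ::
  "('v \<Rightarrow> 'k::field) \<Rightarrow> ('v, 'e, 'k) gain_signed_graph \<Rightarrow> ('v, 'e, 'k) gain_signed_graph" where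
  "gain_switch \<theta> G = G\<lparr>gain := (\<lambda>e. gain G e + (\<Sum>(v, t) \<leftarrow> ends G e. of_int t * \<theta> v))\<rparr>"

definition delete_edges ::
  "('v, 'e, 'k) gain_signed_graph \<Rightarrow> 'e set \<Rightarrow> ('v, 'e, 'k) gain_signed_graph" where
  "delete_edges G S = G\<lparr>edges := edges G - S\<rparr>"

text \<open>
  The collapsing step of the contraction, applied after switching: an edge end at \<open>v\<close> moves to
  the block of \<open>\<pi>\<^sub>b(S)\<close> containing \<open>v\<close> and disappears if there is none.
\<close>

definition collapse ::
  "('v, 'e, 'k) gain_signed_graph \<Rightarrow> 'e set \<Rightarrow> ('v set, 'e, 'k) gain_signed_graph" where
  "collapse G S =
     (let new_ends = (\<lambda>e. map (\<lambda>(v, t). (component_of G S v, t))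
                         (filter (\<lambda>(v, t). component_of G S v \<in> balanced_blocks G S) (ends G e)))
      in \<lparr>verts = balanced_blocks G S,
          edges = edges G - S,
          ends = new_ends,
          esign = (\<lambda>e. if length (new_ends e) = 2 then esign G e
                       else if length (new_ends e) = 1 then -1 else 1),
          gain = gain G\<rparr>)"

definition positive_switcher ::
  "('v, 'e, 'k) gain_signed_graph \<Rightarrow> 'e set \<Rightarrow> ('v \<Rightarrow> int) \<Rightarrow> bool" where
  "positive_switcher G S \<zeta> \<longleftrightarrow> (\<forall>v \<in> verts G. \<zeta> v \<in> {1, -1}) \<and>
     (\<forall>B \<in> balanced_blocks G S. \<forall>e \<in> component_edges G S B. esign (sign_switch \<zeta> G) e = 1)"

definition neutral_switcher ::
  "('v, 'e, 'k::field) gain_signed_graph \<Rightarrow> 'e set \<Rightarrow> ('v \<Rightarrow> 'k) \<Rightarrow> bool" where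
  "neutral_switcher G S \<theta> \<longleftrightarrow> (\<forall>e \<in> S. gain (gain_switch \<theta> G) e = 0)"

text \<open>
  The contraction depends on the choice of the switching functions, so it is a relation:
  \<open>is_contraction G S H\<close> says that \<open>H\<close> is \<open>G / S\<close> formed with some admissible choice.
\<close>

definition is_contraction ::
  "('v, 'e, 'k::field) gain_signed_graph \<Rightarrow> 'e set \<Rightarrow> ('v set, 'e, 'k) gain_signed_graph \<Rightarrow> bool" where
  "is_contraction G S H \<longleftrightarrow>
     (\<exists>\<zeta>. positive_switcher G S \<zeta> \<and>
        (if hyperbalanced G S
         then \<exists>\<theta>. neutral_switcher G S \<theta> \<and> H = collapse (sign_switch \<zeta> (gain_switch \<theta> G)) S
         else H = (collapse (sign_switch \<zeta> G) S)\<lparr>gain := (\<lambda>_. 0)\<rparr>))"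

end

(*
  Let e act on potentials theta : V -> K by lin e theta = (sum of tau(v,e) theta(v) over the ends of e).
  Then S is hyperbalanced iff the affine system gain e + lin e theta = 0 (e in S) is solvable, and
  3 ^ b(S) counts the {-1,0,1}-valued solutions of lin e theta = 0 (e in S). The rank function of the
  matroid is thus read off solution sets. Deletion does not change the equations of the remaining
  edges. The solutions for S are, after switching, the functions that are constant on each
  sign-balanced block and zero elsewhere, so those for A Un S correspond to the solutions for A in
  the contraction.

  The hard half of the first claim is that neutrality of the sign circuits makes every positive
  closed walk W neutral. W acts on the potential at its base point by an affine map, and a shortest
  W acting nontrivially visits no vertex three times; its repeated vertices then force it to be a
  positive circle or, after replacing one connecting path by the reverse of the other, the circuit
  walk of a handcuff. Half edges are treated as negative loops with doubled gain.
*)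
theory Submission
  imports Defs
begin

section \<open>Closed walks in signed voltage graphs\<close>

text \<open>A sign circuit of the contraction has no evident counterpart among the sign circuits of
  A Un S, whereas linear equations for a potential pass through the collapse unchanged; hence both
  terms of the rank are expressed by solutions. Kernel elements are counted over the integers with
  values in {-1, 0, 1} because K may be infinite: each sign-balanced block contributes three
  choices, every other component only zero. Characteristic other than 2 is used to find the fixed
  point g / 2 of a negative closed walk y |-> g - y, to trade a half edge for a loop with doubled
  gain, and to make K-valued kernel elements vanish on unbalanced components. If S is
  hyperfrustrated, so is every A Un S; the two corrections \<delta> then cancel, and a contraction
  with zero gains, being hyperbalanced, has exactly the right rank.\<close>

locale voltage_darts =
  fixes D :: "'d set" and src tgt :: "'d \<Rightarrow> 'v" and opp :: "'d \<Rightarrow> 'd"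
    and sg :: "'d \<Rightarrow> int" and gn :: "'d \<Rightarrow> 'k::field"
  assumes opp_D: "d \<in> D \<Longrightarrow> opp d \<in> D"
    and src_opp: "d \<in> D \<Longrightarrow> src (opp d) = tgt d"
    and tgt_opp: "d \<in> D \<Longrightarrow> tgt (opp d) = src d"
    and opp_opp: "d \<in> D \<Longrightarrow> opp (opp d) = d"
    and sg_opp: "d \<in> D \<Longrightarrow> sg (opp d) = sg d"
    and gn_opp: "d \<in> D \<Longrightarrow> gn (opp d) = - (of_int (sg d) * gn d)"
    and sg_cases: "d \<in> D \<Longrightarrow> sg d = 1 \<or> sg d = -1"
begin

fun dwalk :: "'v \<Rightarrow> 'd list \<Rightarrow> 'v \<Rightarrow> bool" where
  "dwalk u [] w \<longleftrightarrow> u = w"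
| "dwalk u (d # W) w \<longleftrightarrow> d \<in> D \<and> src d = u \<and> dwalk (tgt d) W w"

definition wsg :: "'d list \<Rightarrow> int" where
  "wsg W = (\<Prod>d\<leftarrow>W. sg d)"

fun wgn :: "'d list \<Rightarrow> 'k" where
  "wgn [] = 0"
| "wgn (d # W) = gn d + of_int (sg d) * wgn W"

definition wopp :: "'d list \<Rightarrow> 'd list" where
  "wopp W = rev (map opp W)"

text \<open>A walk carries a potential at its last vertex back to the potential that it forces at its
  first vertex. A closed walk is consistent with some potential at its base iff this affine map
  has a fixed point.\<close>

definition act :: "'d list \<Rightarrow> 'k \<Rightarrow> 'k" where
  "act W y = wgn W + of_int (wsg W) * y"

lemma wsg_simps [simp]: "wsg [] = 1" "wsg (d # W) = sg d * wsg W" "wsg (A @ B) = wsg A * wsg B"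
  by (simp_all add: wsg_def)

lemma act_Nil [simp]: "act [] y = y"
  by (simp add: act_def)

lemma act_Cons: "act (d # W) y = act [d] (act W y)"
  by (simp add: act_def algebra_simps)

lemma act_append [simp]: "act (A @ B) y = act A (act B y)"
proof (induction A)
  case (Cons d A)
  then show ?case
    by (metis act_Cons append_Cons)
qed simp

lemma dwalk_append: "dwalk u (A @ B) w \<longleftrightarrow> (\<exists>x. dwalk u A x \<and> dwalk x B w)"
  by (induction A arbitrary: u) auto

lemma dwalk_D: "dwalk u W w \<Longrightarrow> set W \<subseteq> D"
  by (induction W arbitrary: u) auto

lemma wopp_simps [simp]: "wopp [] = []" "wopp (d # W) = wopp W @ [opp d]"
  "wopp (A @ B) = wopp B @ wopp A" "length (wopp W) = length W" "wopp W = [] \<longleftrightarrow> W = []"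
  by (simp_all add: wopp_def)

lemma wopp_wopp: "set W \<subseteq> D \<Longrightarrow> wopp (wopp W) = W"
  by (induction W) (auto simp: opp_opp)

lemma dwalk_wopp: "dwalk u W w \<Longrightarrow> dwalk w (wopp W) u"
  by (induction W arbitrary: u) (auto simp: dwalk_append opp_D src_opp tgt_opp)

lemma wsg_wopp: "set W \<subseteq> D \<Longrightarrow> wsg (wopp W) = wsg W"
  by (induction W) (auto simp: sg_opp)

lemma wsg_cases: "set W \<subseteq> D \<Longrightarrow> wsg W = 1 \<or> wsg W = -1"
  by (induction W) (use sg_cases in force)+

text \<open>This is what \<open>gn_opp\<close> is for: a dart of sign \<sigma> and gain g acts as y
  |-> g + \<sigma> y, whose inverse is y |-> -\<sigma> g + \<sigma> y because \<sigma>^2 =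
  1.\<close>

lemma act_opp:
  assumes "d \<in> D"
  shows "act [opp d] (act [d] y) = y" "act [d] (act [opp d] y) = y"
  using sg_cases[OF assms] sg_opp[OF assms] gn_opp[OF assms] by (auto simp: act_def)

lemma act_wopp: "set W \<subseteq> D \<Longrightarrow> act (wopp W) (act W y) = y"
proof (induction W arbitrary: y)
  case (Cons d W)
  then show ?case
    by (subst act_Cons) (simp add: act_opp)
qed simp

lemma act_wopp': "set W \<subseteq> D \<Longrightarrow> act W (act (wopp W) y) = y"
proof (induction W arbitrary: y)
  case (Cons d W)
  then show ?case
    by (subst act_Cons) (simp add: act_opp)
qed simp

text \<open>A walk of sign -1 acts as a reflection y |-> g - y, so its square is trivial whatever g
  is.\<close>

lemma act_involution: "wsg W = -1 \<Longrightarrow> act W (act W y) = y"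
  by (simp add: act_def)

section \<open>Cutting walks at a vertex\<close>

lemma dwalk_split_src:
  assumes "dwalk u W w" "x \<in> src ` set W"
  obtains W1 W2 where "W = W1 @ W2" "W2 \<noteq> []" "dwalk u W1 x" "dwalk x W2 w"
proof -
  obtain d where d: "d \<in> set W" "src d = x" using assms(2) by auto
  obtain W1 W2 where W: "W = W1 @ d # W2" using split_list[OF d(1)] by blast
  show ?thesis
    using assms(1) W d(2) by (intro that[of W1 "d # W2"]) (auto simp: dwalk_append)
qed

lemma dwalk_split_tgt:
  assumes "dwalk u W w" "x \<in> tgt ` set W"
  obtains W1 W2 where "W = W1 @ W2" "W1 \<noteq> []" "dwalk u W1 x" "dwalk x W2 w"
proof -
  obtain d where d: "d \<in> set W" "tgt d = x" using assms(2) by auto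
  obtain W1 W2 where W: "W = W1 @ d # W2" using split_list[OF d(1)] by blast
  show ?thesis
    using assms(1) W d(2) by (intro that[of "W1 @ [d]" W2]) (auto simp: dwalk_append)
qed

text \<open>Cutting before two equal tails keeps both the loop \<open>Y\<close> and the rest
  \<open>Z\<close> nonempty; this gives the strict decrease of length in the inductions
  below.\<close>

lemma dwalk_repeated_src:
  assumes "dwalk u W w" "\<not> distinct (map src W)"
  obtains X Y Z x where "W = X @ Y @ Z" "Y \<noteq> []" "Z \<noteq> []"
    "dwalk u X x" "dwalk x Y x" "dwalk x Z w"
proof -
  obtain as x bs cs where "map src W = as @ [x] @ bs @ [x] @ cs"
    using not_distinct_decomp[OF assms(2)] by blast
  then obtain X d Y d' Z where "W = X @ d # Y @ d' # Z" "src d = x" "src d' = x"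
    by (auto simp: map_eq_append_conv map_eq_Cons_conv Cons_eq_map_conv append_eq_map_conv)
  then show ?thesis
    using assms(1) by (intro that[of X "d # Y" "d' # Z" x]) (auto simp: dwalk_append)
qed

lemma dwalk_repeated_tgt:
  assumes "dwalk u W w" "\<not> distinct (map tgt W)"
  obtains X Y Z x where "W = X @ Y @ Z" "Y \<noteq> []" "X \<noteq> []"
    "dwalk u X x" "dwalk x Y x" "dwalk x Z w"
proof -
  obtain as x bs cs where "map tgt W = as @ [x] @ bs @ [x] @ cs"
    using not_distinct_decomp[OF assms(2)] by blast
  then obtain X d Y d' Z where "W = X @ d # Y @ d' # Z" "tgt d = x" "tgt d' = x"
    by (auto simp: map_eq_append_conv map_eq_Cons_conv Cons_eq_map_conv append_eq_map_conv)
  then show ?thesis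
    using assms(1) by (intro that[of "X @ [d]" "Y @ [d']" Z x]) (auto simp: dwalk_append)
qed

text \<open>At a repeated vertex the walk splits into a loop and a remainder whose signs multiply to
  -1, so one of the two is negative and shorter.\<close>

lemma negative_closed_dwalk_simple:
  assumes "dwalk u W u" "wsg W = -1"
  shows "\<exists>v C. dwalk v C v \<and> wsg C = -1 \<and> distinct (map src C) \<and> set C \<subseteq> set W"
  using assms
proof (induction "length W" arbitrary: u W rule: less_induct)
  case less
  show ?case
  proof (cases "distinct (map src W)")
    case True
    then show ?thesis using less.prems by blast
  next
    case False
    obtain X Y Z x where s: "W = X @ Y @ Z" "Y \<noteq> []" "Z \<noteq> []"
      "dwalk u X x" "dwalk x Y x" "dwalk x Z u"
      using dwalk_repeated_src[OF less.prems(1) False] by metis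
    have XZ: "dwalk u (X @ Z) u" using s by (auto simp: dwalk_append)
    have "wsg Y = 1 \<or> wsg Y = -1" using wsg_cases dwalk_D s(5) by blast
    then show ?thesis
    proof
      assume "wsg Y = 1"
      then have "wsg (X @ Z) = -1" using less.prems(2) s(1) by simp
      then show ?thesis using less.hyps[OF _ XZ] s by fastforce
    next
      assume "wsg Y = -1"
      then show ?thesis using less.hyps[OF _ s(5)] s by fastforce
    qed
  qed
qed

section \<open>Shortest positive closed walks with nontrivial action\<close>

definition inert :: "'d list \<Rightarrow> bool" where
  "inert W \<longleftrightarrow> (\<forall>y. act W y = y)"

text \<open>A minimal counterexample to the claim that positive closed walks are inert. Minimality
  ranges over all base vertices, since rotating a walk or cutting out a loop moves the base.\<close>

definition critical :: "'v \<Rightarrow> 'd list \<Rightarrow> bool" where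
  "critical u W \<longleftrightarrow> dwalk u W u \<and> wsg W = 1 \<and> \<not> inert W \<and>
     (\<forall>u' W'. dwalk u' W' u' \<longrightarrow> wsg W' = 1 \<longrightarrow> length W' < length W \<longrightarrow> inert W')"

lemma critical_shorter:
  "critical u W \<Longrightarrow> dwalk v V v \<Longrightarrow> wsg V = 1 \<Longrightarrow> length V < length W \<Longrightarrow> act V y = y"
  unfolding critical_def inert_def by blast

text \<open>If \<open>Y\<close> were positive, then \<open>Y\<close> and \<open>X @ Z\<close> would
  both be shorter positive closed walks, hence inert, and the whole walk would act
  trivially.\<close>

lemma critical_subwalk:
  assumes "critical u (X @ Y @ Z)" "dwalk u X x" "dwalk x Y x" "dwalk x Z u"
    and "Y \<noteq> []" "X @ Z \<noteq> []"
  shows "wsg Y = -1"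
proof (rule ccontr)
  assume "wsg Y \<noteq> -1"
  then have Y: "wsg Y = 1" using wsg_cases dwalk_D assms(3) by blast
  have "act Y y = y" for y
    using critical_shorter[OF assms(1) assms(3) Y] assms(6) by simp
  moreover have "dwalk u (X @ Z) u" using assms by (auto simp: dwalk_append)
  moreover have "wsg (X @ Z) = 1" using assms(1) Y by (simp add: critical_def)
  ultimately have "act (X @ Y @ Z) y = y" for y
    using critical_shorter[OF assms(1), of u "X @ Z" y] assms(5) by simp
  then show False using assms(1) by (auto simp: critical_def inert_def)
qed

text \<open>Three visits to x would make \<open>Y1\<close>, \<open>Y2\<close> and
  \<open>Y1 @ Y2\<close> all negative, against multiplicativity of the sign.\<close>

lemma critical_three_visits:
  assumes "critical u (X @ Y1 @ Y2 @ Z)" "dwalk u X x" "dwalk x Y1 x" "dwalk x Y2 x" "dwalk x Z u"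
    and "Y1 \<noteq> []" "Y2 \<noteq> []" "X @ Z \<noteq> []"
  shows False
proof -
  have "wsg Y1 = -1"
    using critical_subwalk[of u X Y1 "Y2 @ Z" x] assms by (auto simp: dwalk_append)
  moreover have "wsg Y2 = -1"
    using critical_subwalk[of u "X @ Y1" Y2 "Z" x] assms by (auto simp: dwalk_append)
  moreover have "wsg (Y1 @ Y2) = -1"
    using critical_subwalk[of u "X" "Y1 @ Y2" "Z" x] assms by (auto simp: dwalk_append)
  ultimately show False by simp
qed

text \<open>The actions of the two rotations are conjugate under the action of \<open>X\<close>, and
  length and sign do not change.\<close>

lemma critical_rotate:
  assumes "critical u (X @ Y)" "dwalk u X x" "dwalk x Y u"
  shows "critical x (Y @ X)"
proof -
  have "inert (X @ Y)" if "inert (Y @ X)"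
    unfolding inert_def
  proof
    fix y
    have D: "set X \<subseteq> D" using assms(2) dwalk_D by blast
    have "act (X @ Y) (act X (act (wopp X) y)) = act X (act (Y @ X) (act (wopp X) y))" by simp
    also have "\<dots> = y" using that D unfolding inert_def by (metis act_wopp')
    finally show "act (X @ Y) y = y" unfolding act_wopp'[OF D] .
  qed
  then show ?thesis
    using assms by (auto simp: critical_def dwalk_append mult.commute add.commute)
qed

text \<open>Descent to an innermost repetition: a loop cut out of a proper closed subwalk is again
  proper, and criticality makes it negative.\<close>

lemma critical_simple_subwalk:
  assumes "critical u (X @ Y @ Z)" "dwalk u X x" "dwalk x Y x" "dwalk x Z u" "Y \<noteq> []" "X @ Z \<noteq> []"
  shows "\<exists>P C Q w. Y = P @ C @ Q \<and> dwalk x P w \<and> dwalk w C w \<and> dwalk w Q x \<and>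
    distinct (map src C) \<and> C \<noteq> [] \<and> wsg C = -1"
  using assms
proof (induction "length Y" arbitrary: X Y Z x rule: less_induct)
  case less
  show ?case
  proof (cases "distinct (map src Y)")
    case True
    show ?thesis
    proof (intro exI conjI)
      show "Y = [] @ Y @ []" "dwalk x [] x" "dwalk x [] x" by simp_all
    qed (use True critical_subwalk[OF less.prems] less.prems(3,5) in auto)
  next
    case False
    obtain X' Y' Z' x' where s: "Y = X' @ Y' @ Z'" "Y' \<noteq> []" "Z' \<noteq> []"
      "dwalk x X' x'" "dwalk x' Y' x'" "dwalk x' Z' x"
      using dwalk_repeated_src[OF less.prems(3) False] by metis
    have "\<exists>P C Q w. Y' = P @ C @ Q \<and> dwalk x' P w \<and> dwalk w C w \<and> dwalk w Q x' \<and>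
        distinct (map src C) \<and> C \<noteq> [] \<and> wsg C = -1"
      using less.prems s
      by (intro less.hyps[of Y' "X @ X'" "Z' @ Z" x']) (auto simp: dwalk_append)
    then obtain P C Q w where t: "Y' = P @ C @ Q" "dwalk x' P w" "dwalk w C w" "dwalk w Q x'"
        "distinct (map src C)" "C \<noteq> []" "wsg C = -1" by blast
    show ?thesis
    proof (intro exI conjI)
      show "Y = (X' @ P) @ C @ (Q @ Z')" using s(1) t(1) by simp
      show "dwalk x (X' @ P) w" using s(4) t(2) dwalk_append by blast
      show "dwalk w (Q @ Z') x" using s(6) t(4) dwalk_append by blast
    qed (use t in auto)
  qed
qed

lemma src_closed: "dwalk v W v \<Longrightarrow> W \<noteq> [] \<Longrightarrow> v \<in> src ` set W"
  by (cases W) auto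

lemma dwalk_vertices: "dwalk u W w \<Longrightarrow> insert u (tgt ` set W) = insert w (src ` set W)"
  by (induction W arbitrary: u) (auto simp: insert_commute)

text \<open>The handcuff in terms of darts, where a half edge is a closed walk of one dart. The
  clause on singletons keeps the figures distinct: figures with one common vertex can coincide only
  as the same loop or half edge.\<close>

definition dcuff :: "'v \<Rightarrow> 'd list \<Rightarrow> 'd list \<Rightarrow> 'v \<Rightarrow> 'd list \<Rightarrow> bool" where
  "dcuff v A P w C \<longleftrightarrow> dwalk v A v \<and> dwalk v P w \<and> dwalk w C w \<and> A \<noteq> [] \<and> C \<noteq> [] \<and>
     wsg A = -1 \<and> wsg C = -1 \<and> distinct (map src A) \<and> distinct (map src C) \<and>
     distinct (v # map tgt P) \<and>
     (if P = [] then src ` set A \<inter> src ` set C = {v} \<and>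
        (\<forall>d. A = [d] \<longrightarrow> C \<noteq> [d] \<and> C \<noteq> [opp d])
      else src ` set A \<inter> src ` set C = {} \<and>
        set (v # map tgt P) \<inter> src ` set A = {v} \<and> set (v # map tgt P) \<inter> src ` set C = {w})"

text \<open>The closed walk runs along \<open>P\<close> twice, so a vertex that recurs on
  \<open>P\<close>, or an illegal contact of \<open>P\<close> with \<open>A\<close> or
  \<open>C\<close>, would be visited three times. A common vertex of \<open>A\<close> and
  \<open>C\<close> off \<open>P\<close> is visited only twice and needs a separate argument.\<close>

lemma critical_dcuff:
  assumes crit: "critical v (A @ P @ C @ wopp P)"
    and A: "dwalk v A v" "A \<noteq> []" "wsg A = -1" "distinct (map src A)"
    and C: "dwalk w C w" "C \<noteq> []" "wsg C = -1" "distinct (map src C)"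
    and P: "dwalk v P w"
  shows "dcuff v A P w C"
proof -
  have PD: "set P \<subseteq> D" using P dwalk_D by blast
  have AP: "src ` set A \<inter> tgt ` set P = {}"
  proof (rule ccontr)
    assume "\<not> ?thesis"
    then obtain x where x: "x \<in> src ` set A" "x \<in> tgt ` set P" by blast
    obtain A1 A2 where a: "A = A1 @ A2" "A2 \<noteq> []" "dwalk v A1 x" "dwalk x A2 v"
      using dwalk_split_src[OF A(1) x(1)] by metis
    obtain P1 P2 where p: "P = P1 @ P2" "P1 \<noteq> []" "dwalk v P1 x" "dwalk x P2 w"
      using dwalk_split_tgt[OF P x(2)] by metis
    show False
      using critical_three_visits[of v A1 "A2 @ P1" "P2 @ C @ wopp P2" "wopp P1" x]
        crit a p C(1,2) dwalk_wopp[OF p(3)] dwalk_wopp[OF p(4)] by (auto simp: dwalk_append)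
  qed
  have PC: "src ` set P \<inter> src ` set C = {}"
  proof (rule ccontr)
    assume "\<not> ?thesis"
    then obtain x where x: "x \<in> src ` set P" "x \<in> src ` set C" by blast
    obtain P1 P2 where p: "P = P1 @ P2" "P2 \<noteq> []" "dwalk v P1 x" "dwalk x P2 w"
      using dwalk_split_src[OF P x(1)] by metis
    obtain C1 C2 where c: "C = C1 @ C2" "C2 \<noteq> []" "dwalk w C1 x" "dwalk x C2 w"
      using dwalk_split_src[OF C(1) x(2)] by metis
    show False
      using critical_three_visits[of v "A @ P1" "P2 @ C1" "C2 @ wopp P2" "wopp P1" x]
        crit c p A(1,2) dwalk_wopp[OF p(3)] dwalk_wopp[OF p(4)] by (auto simp: dwalk_append)
  qed
  have dP: "distinct (map tgt P)"
  proof (rule ccontr)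
    assume "\<not> ?thesis"
    then obtain X Y Z x where p: "P = X @ Y @ Z" "Y \<noteq> []" "X \<noteq> []"
      "dwalk v X x" "dwalk x Y x" "dwalk x Z w"
      using dwalk_repeated_tgt[OF P] by metis
    show False
      using critical_three_visits[of v "A @ X" "Y" "Z @ C @ wopp Z" "wopp Y @ wopp X" x]
        crit C(1,2) p A(1,2) dwalk_wopp[OF p(4)] dwalk_wopp[OF p(5)] dwalk_wopp[OF p(6)]
      by (auto simp: dwalk_append)
  qed
  have vA: "v \<in> src ` set A" and wC: "w \<in> src ` set C"
    using A C src_closed by auto
  \<comment> \<open>The vertex x cuts both figures into arcs. The closed walk
    \<open>A2 @ P @ C1\<close> is negative, so replacing \<open>C1\<close> or \<open>A2\<close> by
    the reverse of the complementary arc makes it positive; being shorter than the critical walk,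
    the result is inert. The two identities obtained turn the action of the whole walk into that of
    \<open>P\<close>, then \<open>C\<close> twice, then \<open>P\<close> back, and the reflection
    \<open>C\<close> squares to the identity.\<close>
  have AC: "P = [] \<and> x = v" if x: "x \<in> src ` set A" "x \<in> src ` set C" for x
  proof (rule ccontr)
    assume ne: "\<not> ?thesis"
    obtain A1 A2 where a: "A = A1 @ A2" "A2 \<noteq> []" "dwalk v A1 x" "dwalk x A2 v"
      using dwalk_split_src[OF A(1) x(1)] by metis
    obtain C1 C2 where c: "C = C1 @ C2" "C2 \<noteq> []" "dwalk w C1 x" "dwalk x C2 w"
      using dwalk_split_src[OF C(1) x(2)] by metis
    \<comment> \<open>Gives strict shortness in \<open>e1\<close>, where \<open>C1\<close> may be
      empty; in \<open>e2\<close> it comes from \<open>A2 \<noteq> []\<close>.\<close>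
    have ne': "P \<noteq> [] \<or> A1 \<noteq> []" using ne a by auto
    have D: "set A1 \<subseteq> D" "set A2 \<subseteq> D" "set C1 \<subseteq> D" "set C2 \<subseteq> D"
      using a c dwalk_D by blast+
    have s: "wsg (A2 @ P @ C1) = -1"
      using critical_subwalk[of v A1 "A2 @ P @ C1" "C2 @ wopp P" x] crit a c P dwalk_wopp[OF P]
      by (auto simp: dwalk_append)
    have s1: "wsg (A2 @ P @ wopp C2) = 1"
      using s C(3) c(1) wsg_cases[OF D(4)] wsg_cases[OF D(3)] wsg_wopp[OF D(4)] by auto
    have s2: "wsg (wopp A1 @ P @ C1) = 1"
      using s A(3) a(1) wsg_cases[OF D(2)] wsg_cases[OF D(1)] wsg_wopp[OF D(1)] by auto
    have e1: "act (A2 @ P @ wopp C2) y = y" for y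
      using critical_shorter[OF crit _ s1, of x] a c P dwalk_wopp[OF c(4)] ne'
      by (auto simp: dwalk_append)
    have e2: "act (wopp A1 @ P @ C1) y = y" for y
      using critical_shorter[OF crit _ s2, of x] a c P dwalk_wopp[OF a(3)]
      by (auto simp: dwalk_append)
    have e1': "act A2 (act P y) = act C2 y" for y
      using e1[of "act C2 y"] act_wopp[OF D(4)] by simp
    have e2': "act P (act C1 y) = act A1 y" for y
      using e2[of y] act_wopp'[OF D(1), of "act P (act C1 y)"] by simp
    have "act (A @ P @ C @ wopp P) y = y" for y
    proof -
      have "act (A @ P @ C @ wopp P) y = act P (act C1 (act C2 (act C1 (act C2 (act (wopp P) y)))))"
        unfolding a(1) c(1) act_append e1' e2'[symmetric] ..
      also have "\<dots> = act P (act C (act C (act (wopp P) y)))"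
        by (simp add: c(1))
      also have "\<dots> = y" using act_involution[OF C(3)] act_wopp'[OF PD] by simp
      finally show ?thesis .
    qed
    then show False using crit by (auto simp: critical_def inert_def)
  qed
  \<comment> \<open>The walk would be d followed by d, the square of a reflection, or d followed by
    its opposite, which cancels.\<close>
  have single: "C \<noteq> [d] \<and> C \<noteq> [opp d]" if "P = []" "A = [d]" for d
  proof -
    have dD: "d \<in> D" using A that by auto
    have "act (A @ C) y = y" if C: "C = [d] \<or> C = [opp d]" for y
      using C act_opp[OF dD] act_involution[OF A(3)] \<open>A = [d]\<close> unfolding act_append by auto
    then show ?thesis using crit \<open>P = []\<close> by (auto simp: critical_def inert_def)
  qed
  have "insert v (tgt ` set P) = insert w (src ` set P)" using dwalk_vertices[OF P] .
  then have "set (v # map tgt P) \<inter> src ` set A = {v}" "set (v # map tgt P) \<inter> src ` set C = {w}"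
    using AP PC vA wC by auto
  moreover have "v \<notin> tgt ` set P" using AP vA by blast
  moreover have "src ` set A \<inter> src ` set C = (if P = [] then {v} else {})"
  proof (cases "P = []")
    case True
    then have "v \<in> src ` set C" using P wC by simp
    moreover have "src ` set A \<inter> src ` set C \<subseteq> {v}" using AC by blast
    ultimately have "src ` set A \<inter> src ` set C = {v}" using vA by blast
    then show ?thesis using True by metis
  next
    case False
    then have "src ` set A \<inter> src ` set C = {}" using AC by blast
    then show ?thesis using False by metis
  qed
  ultimately show ?thesis
    unfolding dcuff_def using A C P dP single by (metis distinct.simps(2) list.set_map)
qed

text \<open>A link run there and back also has distinct tails but is no circle; it acts trivially by
  itself, hence its exclusion in \<open>circ\<close>. The hypotheses \<open>circ\<close> and
  \<open>cuff\<close> are the only contact of this argument with sign circuits.\<close>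

theorem positive_closed_inert:
  assumes circ: "\<And>v W. dwalk v W v \<Longrightarrow> W \<noteq> [] \<Longrightarrow> distinct (map src W) \<Longrightarrow> wsg W = 1 \<Longrightarrow>
      (\<forall>d. W \<noteq> [d, opp d]) \<Longrightarrow> inert W"
    and cuff: "\<And>v A P w C. dcuff v A P w C \<Longrightarrow> inert (A @ P @ C @ wopp P)"
    and W: "dwalk u W u" "wsg W = 1"
  shows "inert W"
proof (rule ccontr)
  assume "\<not> inert W"
  define bad where "bad = (\<lambda>W. \<exists>u. dwalk u W u \<and> wsg W = 1 \<and> \<not> inert W)"
  have "bad W" using W \<open>\<not> inert W\<close> by (auto simp: bad_def)
  then obtain W where "bad W" and least: "\<forall>V. bad V \<longrightarrow> length W \<le> length V"
    using ex_has_least_nat[of bad W length] by blast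
  then obtain u where "dwalk u W u" "wsg W = 1" "\<not> inert W" by (auto simp: bad_def)
  moreover have "\<not> bad V" if "length V < length W" for V using least that by auto
  ultimately have crit: "critical u W" unfolding critical_def bad_def by blast
  have W: "dwalk u W u" "wsg W = 1" "\<not> inert W" using crit by (auto simp: critical_def)
  have "\<not> distinct (map src W)"
  proof
    assume d: "distinct (map src W)"
    have "W \<noteq> []" using W(3) by (auto simp: inert_def)
    moreover have "W \<noteq> [d, opp d]" for d
    proof
      assume "W = [d, opp d]"
      then have "act W y = y" for y
        using W(1) act_opp(2)[of d y] by (simp add: act_Cons[of d "[opp d]"])
      then show False using W(3) by (auto simp: inert_def)
    qed
    ultimately show False using circ[OF W(1) _ d W(2)] W(3) by blast
  qed
  then obtain X Y Z x where s: "W = X @ Y @ Z" "Y \<noteq> []" "Z \<noteq> []"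
      "dwalk u X x" "dwalk x Y x" "dwalk x Z u"
    using dwalk_repeated_src[OF W(1)] by metis
  obtain P1 A Q1 v where a: "Y = P1 @ A @ Q1" "dwalk x P1 v" "dwalk v A v" "dwalk v Q1 x"
    "distinct (map src A)" "A \<noteq> []" "wsg A = -1"
    using critical_simple_subwalk[of u X Y Z x] crit s by auto
  \<comment> \<open>The rest of the walk, read from v after rotation; it is a closed subwalk at v
    and so yields a second simple negative loop.\<close>
  define B where "B = Q1 @ Z @ X @ P1"
  have crit': "critical v (A @ B)"
    using critical_rotate[of u "X @ P1" "A @ Q1 @ Z" v] crit s a
    by (auto simp: dwalk_append B_def)
  have B: "dwalk v B v" "B \<noteq> []" using s a by (auto simp: dwalk_append B_def)
  obtain P C Q w where c: "B = P @ C @ Q" "dwalk v P w" "dwalk w C w" "dwalk w Q v"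
    "distinct (map src C)" "C \<noteq> []" "wsg C = -1"
    using critical_simple_subwalk[of v A B "[]" v] crit' B a by auto
  have D: "set P \<subseteq> D" "set Q \<subseteq> D" using c dwalk_D by blast+
  have len: "length (A @ B) \<le> length W" using s a by (simp add: B_def)
  have wPQ: "wsg (P @ Q) = 1"
    using crit' a(7) c by (auto simp: critical_def)
  then have PQ: "act P (act Q y) = y" for y
    using critical_shorter[OF crit' _ wPQ, of v y] c a by (auto simp: dwalk_append)
  have sPQ: "wsg P * wsg P = 1" "wsg Q * wsg Q = 1"
    using wsg_cases[OF D(1)] wsg_cases[OF D(2)] by auto
  have Q: "act Q y = act (wopp P) y" for y
    using PQ act_wopp[OF D(1)] by metis
  have P: "act P y = act (wopp Q) y" for y
    using PQ act_wopp'[OF D(2)] by metis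
  \<comment> \<open>\<open>R\<close> stands for \<open>P\<close> or the reverse of \<open>Q\<close>.
    The exchange alters no action, and the length bound would keep the new walk a shortest
    counterexample, which is what \<open>critical_dcuff\<close> requires.\<close>
  have short: "inert (A @ R @ C @ wopp R)"
    if R: "dwalk v R w" "length (A @ R @ C @ wopp R) \<le> length (A @ B)"
      "\<And>y. act R y = act P y" "\<And>y. act (wopp R) y = act Q y" for R
  proof (rule ccontr)
    assume n: "\<not> ?thesis"
    have "set R \<subseteq> D" using R dwalk_D by blast
    then have "wsg R = 1 \<or> wsg R = -1" "wsg (wopp R) = wsg R"
      using wsg_cases wsg_wopp by auto
    then have "critical v (A @ R @ C @ wopp R)"
      using n crit' R(1,2) a c dwalk_wopp[OF R(1)] unfolding critical_def
      by (auto simp: dwalk_append)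
    then have "dcuff v A R w C" using critical_dcuff a c R(1) by blast
    then show False using cuff n by blast
  qed
  have "inert (A @ P @ C @ Q)"
  \<comment> \<open>Using the shorter of the two connecting paths in both directions does not
    lengthen the walk.\<close>
  proof (cases "length P \<le> length Q")
    case True
    then have "inert (A @ P @ C @ wopp P)"
      using c Q by (intro short) auto
    then show ?thesis by (simp add: inert_def Q)
  next
    case False
    have "wopp (wopp Q) = Q" using wopp_wopp D(2) by blast
    then have "inert (A @ wopp Q @ C @ Q)"
      using short[of "wopp Q"] dwalk_wopp[OF c(4)] False P c(1) by auto
    then show ?thesis by (simp add: inert_def P)
  qed
  then show False using crit' c(1) by (auto simp: critical_def)
qed

section \<open>Potentials from consistent closed walks\<close>

definition dreach :: "'v \<Rightarrow> 'v \<Rightarrow> bool" where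
  "dreach u w \<longleftrightarrow> (\<exists>W. dwalk u W w)"

lemma dreach_refl: "dreach u u"
  unfolding dreach_def by (rule exI[of _ "[]"]) simp

lemma dreach_sym: "dreach u w \<Longrightarrow> dreach w u"
  unfolding dreach_def using dwalk_wopp by blast

lemma dreach_trans: "dreach u v \<Longrightarrow> dreach v w \<Longrightarrow> dreach u w"
  unfolding dreach_def using dwalk_append by blast

text \<open>Chosen from the reachability predicate alone, so that mutually reachable vertices
  receive the same root.\<close>

definition droot :: "'v \<Rightarrow> 'v" where
  "droot v = (SOME r. dreach v r)"

lemma dreach_droot: "dreach v (droot v)"
  unfolding droot_def by (rule someI[of "dreach v" v]) (rule dreach_refl)

lemma droot_cong: "dreach u w \<Longrightarrow> droot u = droot w"
proof -
  assume "dreach u w"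
  then have "dreach u = dreach w" using dreach_sym dreach_trans by blast
  then show ?thesis by (simp add: droot_def)
qed

text \<open>The potential is the sign of a fixed walk to the root; consistency on a dart is the
  hypothesis for the closed walk formed by the dart and the fixed walks of its two ends.\<close>

theorem sign_potential:
  assumes "\<And>u W. dwalk u W u \<Longrightarrow> wsg W = 1"
  obtains \<eta> where "\<And>v. \<eta> v \<in> {1, -1}" "\<And>d. d \<in> D \<Longrightarrow> \<eta> (src d) = sg d * \<eta> (tgt d)"
proof -
  define path where "path v = (SOME W. dwalk v W (droot v))" for v
  have path: "dwalk v (path v) (droot v)" for v
    unfolding path_def using dreach_droot[of v] by (metis dreach_def someI_ex)
  have sq: "wsg (path v) \<in> {1, -1}" for v
    using path wsg_cases dwalk_D by blast
  have "wsg (path (src d)) = sg d * wsg (path (tgt d))" if d: "d \<in> D" for d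
  proof -
    have "dwalk (src d) [d] (tgt d)" using d by simp
    then have "droot (src d) = droot (tgt d)" using droot_cong dreach_def by blast
    then have "dwalk (src d) (d # path (tgt d) @ wopp (path (src d))) (src d)"
      using d path[of "tgt d"] dwalk_wopp[OF path[of "src d"]] by (auto simp: dwalk_append)
    then have "wsg (d # path (tgt d) @ wopp (path (src d))) = 1" using assms by blast
    moreover have "wsg (wopp (path (src d))) = wsg (path (src d))"
      using path wsg_wopp dwalk_D by blast
    ultimately show ?thesis using sq[of "src d"] sq[of "tgt d"] sg_cases[OF d] by auto
  qed
  then show ?thesis using that[of "\<lambda>v. wsg (path v)"] sq by blast
qed

text \<open>Potentials are transported from the root, so only the value there has to be chosen, as a
  common fixed point of all closed walks at the root. A negative closed walk N forces the value
  gain(N) / 2; if there is none, every value is fixed.\<close>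

theorem gain_potential:
  assumes two: "(2::'k) \<noteq> 0"
    and inert: "\<And>u W. dwalk u W u \<Longrightarrow> wsg W = 1 \<Longrightarrow> inert W"
  obtains \<theta> where "\<And>d. d \<in> D \<Longrightarrow> \<theta> (src d) = gn d + of_int (sg d) * \<theta> (tgt d)"
proof -
  define path where "path v = (SOME W. dwalk v W (droot v))" for v
  have path: "dwalk v (path v) (droot v)" for v
    unfolding path_def using dreach_droot[of v] by (metis dreach_def someI_ex)
  have pathD: "set (path v) \<subseteq> D" for v using path dwalk_D by blast
  have "\<exists>y. \<forall>W. dwalk r W r \<longrightarrow> act W y = y" for r
  proof (cases "\<exists>N. dwalk r N r \<and> wsg N = -1")
    case True
    then obtain N where N: "dwalk r N r" "wsg N = -1" by blast
    have fixN: "act N (wgn N / 2) = wgn N / 2"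
      using N two by (simp add: act_def field_simps)
    have "act W (wgn N / 2) = wgn N / 2" if W: "dwalk r W r" for W
    proof (cases "wsg W = 1")
      case True
      then show ?thesis using inert[OF W] by (simp add: inert_def)
    next
      case False
      then have "wsg W = -1" using W wsg_cases dwalk_D by blast
      \<comment> \<open>Since \<open>W\<close> composed with the reflection \<open>N\<close> is
        trivial, \<open>W\<close> has the same fixed point as \<open>N\<close>.\<close>
      then have "inert (W @ N)" using inert[of r "W @ N"] W N by (auto simp: dwalk_append)
      then show ?thesis using fixN by (metis act_append inert_def)
    qed
    then show ?thesis by blast
  next
    case False
    then have "wsg W = 1" if "dwalk r W r" for W using that wsg_cases dwalk_D by blast
    then show ?thesis using inert by (auto simp: inert_def)
  qed
  then obtain y where y: "\<And>r W. dwalk r W r \<Longrightarrow> act W (y r) = y r" by metis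
  have "act (path (src d)) (y (droot (src d))) = act [d] (act (path (tgt d)) (y (droot (tgt d))))"
    if d: "d \<in> D" for d
  proof -
    have "dwalk (src d) [d] (tgt d)" using d by simp
    then have r: "droot (src d) = droot (tgt d)" using droot_cong dreach_def by blast
    then have "dwalk (droot (src d)) (wopp (path (src d)) @ d # path (tgt d)) (droot (src d))"
      using d path[of "tgt d"] dwalk_wopp[OF path[of "src d"]] by (auto simp: dwalk_append)
    then have "act (wopp (path (src d))) (act (d # path (tgt d)) (y (droot (src d)))) = y (droot (src d))"
      using y by (metis act_append)
    then show ?thesis using act_wopp'[OF pathD] r by (metis act_Cons)
  qed
  then show ?thesis
    using that[of "\<lambda>v. act (path v) (y (droot v))"] by (simp add: act_def)
qed

end

section \<open>Darts of a gain signed graph\<close>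

definition lin :: "('v, 'e, 'k) gain_signed_graph \<Rightarrow> 'e \<Rightarrow> ('v \<Rightarrow> 'r::comm_ring_1) \<Rightarrow> 'r" where
  "lin G e \<theta> = (\<Sum>(v, t) \<leftarrow> ends G e. of_int t * \<theta> v)"

lemma gsg_edge_cases:
  assumes "is_gain_signed_graph G" "e \<in> edges G"
  obtains v t w s where "ends G e = [(v, t), (w, s)]" "v \<in> verts G" "w \<in> verts G"
      "t = 1 \<or> t = -1" "s = -esign G e * t" "esign G e = 1 \<or> esign G e = -1" "link_or_loop G e"
  | v t where "ends G e = [(v, t)]" "v \<in> verts G" "t = 1 \<or> t = -1" "esign G e = -1" "half_edge G e"
  | "ends G e = []" "esign G e = 1" "loose_edge G e"
proof -
  have G: "link_or_loop G e \<or> half_edge G e \<or> loose_edge G e"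
    "\<forall>(v, t) \<in> set (ends G e). v \<in> verts G \<and> t \<in> {1, -1}" "esign G e \<in> {1, -1}"
    "link_or_loop G e \<Longrightarrow> snd (ends G e ! 0) * snd (ends G e ! 1) = - esign G e"
    "half_edge G e \<Longrightarrow> esign G e = -1" "loose_edge G e \<Longrightarrow> esign G e = 1"
    using assms unfolding is_gain_signed_graph_def by blast+
  from G(1) consider "link_or_loop G e" | "half_edge G e" | "loose_edge G e" by blast
  then show ?thesis
  proof cases
    case 1
    then obtain v t w s where e: "ends G e = [(v, t), (w, s)]"
      unfolding link_or_loop_def by (auto simp: length_Suc_conv numeral_2_eq_2)
    moreover have "t * s = - esign G e" using G(4)[OF 1] e by simp
    moreover have "t = 1 \<or> t = -1" using G(2) e by auto
    ultimately have "s = - esign G e * t" by auto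
    then show ?thesis using that(1)[of v t w s] e G 1 by auto
  next
    case 2
    then obtain v t where e: "ends G e = [(v, t)]"
      unfolding half_edge_def by (auto simp: length_Suc_conv)
    then show ?thesis using that(2)[of v t] G 2 by auto
  next
    case 3
    then show ?thesis using that(3) G by (auto simp: loose_edge_def)
  qed
qed

definition darts :: "('v, 'e, 'k) gain_signed_graph \<Rightarrow> 'e set \<Rightarrow> ('e \<times> nat) set" where
  "darts G S = {d. fst d \<in> S \<and> snd d < length (ends G (fst d))}"

text \<open>A half edge is treated as a negative loop with doubled gain: since 2 is invertible it imposes
  the same condition on potentials, and sign circuits containing it keep their neutrality.\<close>

definition dart_head :: "('v, 'e, 'k) gain_signed_graph \<Rightarrow> 'e \<times> nat \<Rightarrow> 'v" where
  "dart_head G d = (if length (ends G (fst d)) = 2 then head G d else tail G d)"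

definition dart_opp :: "('v, 'e, 'k) gain_signed_graph \<Rightarrow> 'e \<times> nat \<Rightarrow> 'e \<times> nat" where
  "dart_opp G d = (fst d, if length (ends G (fst d)) = 2 then 1 - snd d else snd d)"

definition dart_sign :: "('v, 'e, 'k) gain_signed_graph \<Rightarrow> 'e \<times> nat \<Rightarrow> int" where
  "dart_sign G d = esign G (fst d)"

definition dart_gain :: "('v, 'e, 'k::field) gain_signed_graph \<Rightarrow> 'e \<times> nat \<Rightarrow> 'k" where
  "dart_gain G d = - ((if length (ends G (fst d)) = 2 then 1 else 2) *
     gain G (fst d) * of_int (tail_sign G d))"

locale gsg_edges =
  fixes G :: "('v, 'e, 'k::field) gain_signed_graph" and S :: "'e set"
  assumes gsg: "is_gain_signed_graph G" and S_edges: "S \<subseteq> edges G"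
begin

lemma dart_cases:
  assumes "d \<in> darts G S"
  obtains e v t w s where "d = (e, 0)" "e \<in> S" "ends G e = [(v, t), (w, s)]" "v \<in> verts G" "w \<in> verts G"
      "t = 1 \<or> t = -1" "s = -esign G e * t" "esign G e = 1 \<or> esign G e = -1" "link_or_loop G e"
  | e v t w s where "d = (e, 1)" "e \<in> S" "ends G e = [(w, s), (v, t)]" "v \<in> verts G" "w \<in> verts G"
      "t = 1 \<or> t = -1" "s = -esign G e * t" "esign G e = 1 \<or> esign G e = -1" "link_or_loop G e"
  | e v t where "d = (e, 0)" "e \<in> S" "ends G e = [(v, t)]" "v \<in> verts G" "t = 1 \<or> t = -1"
      "esign G e = -1" "half_edge G e"
proof -
  obtain e i where d: "d = (e, i)" "e \<in> S" "i < length (ends G e)"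
    using assms by (cases d) (auto simp: darts_def)
  have e: "e \<in> edges G" using d S_edges by blast
  show ?thesis using gsg e
  proof (cases rule: gsg_edge_cases)
    case (1 v t w s)
    then have "i = 0 \<or> i = 1" using d by auto
    then show ?thesis
    proof
      assume "i = 0" then show ?thesis using that(1)[of e v t w s] d 1 by blast
    next
      assume "i = 1"
      moreover have "s = 1 \<or> s = -1" "t = - esign G e * s" using 1 by auto
      ultimately show ?thesis using that(2)[of e v t w s] d 1 by blast
    qed
  next
    case (2 v t)
    then show ?thesis using that(3)[of e v t] d by auto
  next
    case 3
    then show ?thesis using d by auto
  qed
qed

text \<open>A half edge is its own opposite dart. For it \<open>gn_opp\<close> reads g = -(-1) g, so
  the sign -1 of half edges is what makes them fit.\<close>

sublocale voltage_darts "darts G S" "tail G" "dart_head G" "dart_opp G" "dart_sign G" "dart_gain G"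
proof
  fix d assume d: "d \<in> darts G S"
  have tail: "tail G (e, i) = fst (ends G e ! i)" "tail_sign G (e, i) = snd (ends G e ! i)"
    "head G (e, i) = fst (ends G e ! (1 - i))" for e i
    by (simp_all add: tail_def tail_sign_def head_def)
  show "dart_opp G d \<in> darts G S" "tail G (dart_opp G d) = dart_head G d"
    "dart_head G (dart_opp G d) = tail G d" "dart_opp G (dart_opp G d) = d"
    "dart_sign G (dart_opp G d) = dart_sign G d" "dart_sign G d = 1 \<or> dart_sign G d = -1"
    "dart_gain G (dart_opp G d) = - (of_int (dart_sign G d) * dart_gain G d)"
    using d by (cases rule: dart_cases;
        auto simp: darts_def dart_opp_def dart_head_def dart_sign_def dart_gain_def tail)+
qed

lemma dart_verts: "d \<in> darts G S \<Longrightarrow> tail G d \<in> verts G \<and> dart_head G d \<in> verts G"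
  by (cases rule: dart_cases) (auto simp: dart_head_def tail_def head_def)

text \<open>Walks of the graph never run over half edges, walks of darts may; this predicate marks
  their common part.\<close>

definition all_links :: "('e \<times> nat) list \<Rightarrow> bool" where
  "all_links W \<longleftrightarrow> (\<forall>d \<in> set W. length (ends G (fst d)) = 2)"

lemma all_links_simps [simp]: "all_links []"
  "all_links (d # W) \<longleftrightarrow> length (ends G (fst d)) = 2 \<and> all_links W" "all_links (A @ B) \<longleftrightarrow> all_links A \<and> all_links B"
  by (auto simp: all_links_def)

lemma walk_iff_dwalk:
  "walk G u W w \<and> walk_edges W \<subseteq> S \<longleftrightarrow> u \<in> verts G \<and> dwalk u W w \<and> all_links W"
proof (induction W arbitrary: u)
  case (Cons d W)
  have *: "is_step G d \<and> fst d \<in> S \<longleftrightarrow> d \<in> darts G S \<and> length (ends G (fst d)) = 2"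
    using S_edges by (auto simp: is_step_def link_or_loop_def darts_def)
  have "walk_edges (d # W) \<subseteq> S \<longleftrightarrow> fst d \<in> S \<and> walk_edges W \<subseteq> S"
    by (auto simp: walk_edges_def)
  then have "walk G u (d # W) w \<and> walk_edges (d # W) \<subseteq> S \<longleftrightarrow>
     (is_step G d \<and> fst d \<in> S) \<and> tail G d = u \<and> (walk G (head G d) W w \<and> walk_edges W \<subseteq> S)"
    by auto
  also have "\<dots> \<longleftrightarrow> (d \<in> darts G S \<and> length (ends G (fst d)) = 2) \<and> tail G d = u \<and>
     (head G d \<in> verts G \<and> dwalk (head G d) W w \<and> all_links W)"
    by (simp only: * Cons.IH)
  also have "\<dots> \<longleftrightarrow> u \<in> verts G \<and> dwalk u (d # W) w \<and> all_links (d # W)"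
    using dart_verts[of d] by (auto simp: dart_head_def)
  finally show ?case .
qed (simp add: walk_edges_def)

lemma walk_sign_eq: "walk_sign G W = wsg W"
  by (simp add: walk_sign_def wsg_def dart_sign_def)

lemma walk_gain_eq: "all_links W \<Longrightarrow> walk_gain G W = wgn W"
proof (induction W)
  case (Cons d W)
  have "walk_gain G (d # W) = - (gain G (fst d) * of_int (tail_sign G d)) + of_int (esign G (fst d)) * walk_gain G W"
    unfolding walk_gain_def
    by (simp add: sum.lessThan_Suc_shift walk_sign_def sum_distrib_left mult.assoc mult.left_commute
        del: sum.lessThan_Suc)
  then show ?case using Cons by (simp add: dart_gain_def[of G d] dart_sign_def[of G d])
qed (simp add: walk_gain_def)

lemma walk_back_eq: "all_links W \<Longrightarrow> walk_back W = wopp W"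
  by (auto simp: walk_back_def wopp_def dart_opp_def all_links_def split: prod.splits)

lemma all_links_wopp: "all_links (wopp W) = all_links W"
  by (auto simp: all_links_def wopp_def dart_opp_def)

text \<open>A half edge dart ends where it starts and would repeat a vertex.\<close>

lemma all_links_if_distinct:
  "dwalk v P w \<Longrightarrow> distinct (v # map (dart_head G) P) \<Longrightarrow> all_links P"
proof (induction P arbitrary: v)
  case (Cons d P)
  then have "length (ends G (fst d)) = 2"
    by (auto simp: dart_head_def[of G d])
  then show ?case using Cons.IH[of "dart_head G d"] Cons.prems by auto
qed simp

text \<open>The dart is stationary, so the cyclically next dart would have the same tail.\<close>

lemma half_dart_simple_closed:
  assumes "dwalk v W v" "distinct (map (tail G) W)" "d \<in> set W" "length (ends G (fst d)) \<noteq> 2"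
  shows "W = [d]"
proof -
  obtain X Y where W: "W = X @ d # Y" using split_list[OF assms(3)] by blast
  have h: "dart_head G d = tail G d" using assms(4) by (simp add: dart_head_def)
  have "Y = []" using assms(1,2) W h by (cases Y) (auto simp: dwalk_append)
  moreover from this have "X = []" using assms(1,2) W h by (cases X) (auto simp: dwalk_append)
  ultimately show ?thesis using W by simp
qed

text \<open>Using a link twice in one direction repeats its tail. Using it in both directions makes
  the second tail the first head, and distinctness then leaves no room for any other dart.\<close>

lemma simple_closed_distinct_edges:
  assumes "dwalk v W v" "distinct (map (tail G) W)" "all_links W" "\<forall>d. W \<noteq> [d, dart_opp G d]"
  shows "distinct (map fst W)"
proof (rule ccontr)
  assume "\<not> ?thesis"
  then obtain X d Y d' Z where W: "W = X @ d # Y @ d' # Z" "fst d = fst d'"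
    by (auto dest!: not_distinct_decomp simp: map_eq_append_conv map_eq_Cons_conv
        Cons_eq_map_conv append_eq_map_conv)
  have D: "d \<in> darts G S" "d' \<in> darts G S" "length (ends G (fst d)) = 2"
    using dwalk_D[OF assms(1)] W assms(3) by auto
  have "tail G d \<noteq> tail G d'" using W assms(2) by auto
  then have "snd d \<noteq> snd d'" using W(2) by (metis prod_eqI)
  then have opp: "d' = dart_opp G d"
    using D W(2) by (cases d; cases d') (auto simp: darts_def dart_opp_def)
  then have t: "tail G d' = dart_head G d" "dart_head G d' = tail G d"
    using src_opp tgt_opp D(1) by auto
  have "Y = []" using assms(1,2) W t by (cases Y) (auto simp: dwalk_append)
  moreover have "Z = []" using assms(1,2) W t by (cases Z) (auto simp: dwalk_append)
  moreover from calculation have "X = []" using assms(1,2) W t by (cases X) (auto simp: dwalk_append)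
  ultimately show False using W opp assms(4) by auto
qed

section \<open>Simple closed walks as circles and negative figures\<close>

lemma link_end_count:
  assumes "d \<in> darts G S" "length (ends G (fst d)) = 2"
  shows "length (filter (\<lambda>p. fst p = v) (ends G (fst d))) =
    (if tail G d = v then 1 else 0) + (if dart_head G d = v then 1 else 0)"
  using assms(1) by (cases rule: dart_cases) (use assms(2) in \<open>auto simp: tail_def head_def dart_head_def\<close>)

lemma vertex_set_dart: "d \<in> darts G S \<Longrightarrow> fst ` set (ends G (fst d)) = {tail G d, dart_head G d}"
  by (cases rule: dart_cases) (auto simp: tail_def head_def dart_head_def)

lemma closed_tgt_src:
  assumes "dwalk v W v"
  shows "dart_head G ` set W = tail G ` set W"
proof (cases "W = []")
  case False
  have "v \<in> tail G ` set W" using src_closed[OF assms False] .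
  moreover have "v \<in> dart_head G ` set W"
    using assms False by (cases W rule: rev_cases) (auto simp: dwalk_append)
  ultimately show ?thesis using dwalk_vertices[OF assms] by (simp add: insert_absorb)
qed simp

lemma vertex_set_closed: "dwalk v W v \<Longrightarrow> vertex_set G (fst ` set W) = tail G ` set W"
proof -
  assume W: "dwalk v W v"
  have "vertex_set G (fst ` set W) = (\<Union>d\<in>set W. fst ` set (ends G (fst d)))"
    by (simp add: vertex_set_def)
  also have "\<dots> = (\<Union>d\<in>set W. {tail G d, dart_head G d})"
    using vertex_set_dart dwalk_D[OF W] by (intro SUP_cong refl) blast
  finally have "vertex_set G (fst ` set W) = (\<Union>d\<in>set W. {tail G d, dart_head G d})" .
  then show ?thesis using closed_tgt_src[OF W] by auto
qed

text \<open>A closed walk has the same set of heads as of tails, so distinct tails give distinct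
  heads; each vertex is then the tail of one dart and the head of one, which is degree 2.\<close>

lemma simple_closed_circle:
  assumes W: "dwalk v W v" and ne: "W \<noteq> []" and dist: "distinct (map (tail G) W)"
    and linked: "all_links W" and opp: "\<forall>d. W \<noteq> [d, dart_opp G d]"
  shows "circle G (fst ` set W)" "once_around G (fst ` set W) v W"
    "(\<Prod>e\<in>fst ` set W. esign G e) = wsg W"
proof -
  have df: "distinct (map fst W)" using simple_closed_distinct_edges[OF W dist linked opp] .
  then have dW: "distinct W" and inj: "inj_on fst (set W)" by (auto simp: distinct_map)
  have D: "set W \<subseteq> darts G S" using dwalk_D[OF W] .
  have len: "length (ends G (fst d)) = 2" if "d \<in> set W" for d
    using linked that by (simp add: all_links_def)
  have S: "fst ` set W \<subseteq> S" using D by (auto simp: darts_def)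
  have injt: "inj_on (tail G) (set W)" using dist by (simp add: distinct_map)
  have injh: "inj_on (dart_head G) (set W)"
    using closed_tgt_src[OF W] injt by (intro eq_card_imp_inj_on) (simp_all add: card_image)
  have one: "(\<Sum>d\<in>set W. if f d = x then 1 else 0) = (1::nat)"
    if "inj_on f (set W)" "x \<in> f ` set W" for f :: "'e \<times> nat \<Rightarrow> 'v" and x
  proof -
    have "(\<Sum>d\<in>set W. if f d = x then 1 else 0) = (\<Sum>y\<in>f ` set W. if y = x then 1 else (0::nat))"
      using sum.reindex[OF that(1), of "\<lambda>y. if y = x then 1 else (0::nat)"] unfolding o_def by (rule sym)
    then show ?thesis using that(2) by simp
  qed
  have v: "v \<in> tail G ` set W" using src_closed[OF W ne] .
  show "(\<Prod>e\<in>fst ` set W. esign G e) = wsg W"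
    using inj dW by (simp add: prod.reindex wsg_def dart_sign_def prod.distinct_set_conv_list)
  have vV: "v \<in> verts G" using v D dart_verts by blast
  have "walk G v W v" using walk_iff_dwalk[of v W v] vV W linked by blast
  then show "once_around G (fst ` set W) v W"
    using df by (simp add: once_around_def walk_edges_def)
  have deg: "degree_in G (fst ` set W) x = 2" if x: "x \<in> tail G ` set W" for x
  proof -
    have "degree_in G (fst ` set W) x = (\<Sum>d\<in>set W. length (filter (\<lambda>p. fst p = x) (ends G (fst d))))"
      using inj by (simp add: degree_in_def sum.reindex)
    also have "\<dots> = (\<Sum>d\<in>set W. (if tail G d = x then 1 else 0) + (if dart_head G d = x then 1 else 0))"
      using D len by (intro sum.cong refl link_end_count) auto
    also have "\<dots> = 2"
      using one[OF injt x] one[OF injh, of x] x closed_tgt_src[OF W] by (simp add: sum.distrib)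
    finally show ?thesis .
  qed
  have conn: "connected_by G (fst ` set W) x y" if x: "x \<in> tail G ` set W" and y: "y \<in> tail G ` set W" for x y
  proof -
    obtain X1 X2 where a: "W = X1 @ X2" "dwalk x X2 v" using dwalk_split_src[OF W x] by metis
    obtain Y1 Y2 where b: "W = Y1 @ Y2" "dwalk v Y1 y" using dwalk_split_src[OF W y] by metis
    have "dwalk x (X2 @ Y1) y" using a b dwalk_append by blast
    moreover have "all_links X2" "all_links Y1"
      using linked a(1) b(1) all_links_simps(3) by metis+
    moreover have "x \<in> verts G" using x D dart_verts by blast
    moreover have "set X2 \<subseteq> set W" using a(1) by (metis le_sup_iff set_append subset_refl)
    moreover have "set Y1 \<subseteq> set W" using b(1) by (metis le_sup_iff set_append subset_refl)
    ultimately show ?thesis using walk_iff_dwalk[of x "X2 @ Y1" y]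
      unfolding connected_by_def by (intro exI[of _ "X2 @ Y1"]) (auto simp: walk_edges_def)
  qed
  have links: "\<forall>e\<in>fst ` set W. link_or_loop G e"
    using len S S_edges by (auto simp: link_or_loop_def)
  show "circle G (fst ` set W)"
    unfolding circle_def vertex_set_closed[OF W] using ne links deg conn by auto
qed

text \<open>Going along a link and back has a square as its sign, so that exception to being a
  circle cannot arise. In the half edge case the index 0 ties the dart to
  \<open>half_edge_orient\<close>.\<close>

lemma simple_negative_figure:
  assumes W: "dwalk v W v" "wsg W = -1" "distinct (map (tail G) W)"
  obtains (half) a where "W = [a]" "half_edge G (fst a)" "snd a = 0" "tail G a = v"
  | (circle) "all_links W" "negative_circle G (fst ` set W)" "once_around G (fst ` set W) v W"
proof (cases "all_links W")
  case True
  have ne: "W \<noteq> []" using W(2) by auto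
  have "W \<noteq> [d, dart_opp G d]" for d
  proof
    assume d: "W = [d, dart_opp G d]"
    then have "d \<in> darts G S" using W(1) by simp
    then show False using d W(2) sg_opp[of d] sg_cases[of d] by auto
  qed
  then show ?thesis
    using simple_closed_circle[OF W(1) ne W(3) True] W(2) True by (intro circle) (auto simp: negative_circle_def)
next
  case False
  then obtain a where a: "a \<in> set W" "length (ends G (fst a)) \<noteq> 2" by (auto simp: all_links_def)
  then have Wa: "W = [a]" using half_dart_simple_closed[OF W(1,3)] by blast
  then have D: "a \<in> darts G S" "tail G a = v" using W(1) by auto
  from D(1) show ?thesis
    by (cases rule: dart_cases) (use a(2) Wa D in \<open>auto intro: half\<close>)
qed

lemma negative_figureI:
  assumes "dwalk v W v" "wsg W = -1" "distinct (map (tail G) W)"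
  shows "negative_figure G (fst ` set W)"
  using assms by (cases rule: simple_negative_figure) (auto simp: negative_figure_def)

section \<open>Handcuffs in terms of darts\<close>

lemma wgn_wopp: "set W \<subseteq> darts G S \<Longrightarrow> wgn (wopp W) = - (of_int (wsg W) * wgn W)"
  using act_wopp[of W 0] wsg_wopp[of W] by (simp add: act_def eq_neg_iff_add_eq_0)

lemma dcuff_disjointD:
  assumes "dcuff v A P w C"
  shows "P = [] \<Longrightarrow> tail G ` set A \<inter> tail G ` set C = {v}"
    "P \<noteq> [] \<Longrightarrow> tail G ` set A \<inter> tail G ` set C = {}"
    "P \<noteq> [] \<Longrightarrow> set (v # map (dart_head G) P) \<inter> tail G ` set A = {v}"
    "P \<noteq> [] \<Longrightarrow> set (v # map (dart_head G) P) \<inter> tail G ` set C = {w}"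
  using assms unfolding dcuff_def by simp_all

text \<open>The delicate point is that the figures differ as edge sets. Equal edge sets would have
  equal vertices, forcing \<open>P = []\<close> and a single vertex; both walks would be single
  darts on one edge, which \<open>dcuff\<close> excludes.\<close>

lemma dcuff_handcuff:
  assumes "dcuff v A P w C"
  shows "handcuff G (fst ` set A) v P w (fst ` set C)"
proof -
  have A: "dwalk v A v" "A \<noteq> []" "wsg A = -1" "distinct (map (tail G) A)"
    and C: "dwalk w C w" "C \<noteq> []" "wsg C = -1" "distinct (map (tail G) C)"
    and P: "dwalk v P w" "distinct (v # map (dart_head G) P)"
    using assms unfolding dcuff_def by blast+
  have linked: "all_links P" using all_links_if_distinct[OF P] .
  have vA: "v \<in> tail G ` set A" and wC: "w \<in> tail G ` set C" using A C src_closed by auto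
  have "v \<in> verts G" using vA dwalk_D[OF A(1)] dart_verts by blast
  then have walkP: "walk G v P w" using walk_iff_dwalk P(1) linked by blast
  have "map (head G) P = map (dart_head G) P"
    using linked by (auto simp: all_links_def dart_head_def)
  then have vP: "walk_verts G v P = v # map (dart_head G) P"
    by (simp add: walk_verts_def)
  have neq: "fst ` set A \<noteq> fst ` set C"
  proof
    assume eq: "fst ` set A = fst ` set C"
    then have eqv: "tail G ` set A = tail G ` set C"
      using vertex_set_closed A(1) C(1) by metis
    have "P = []"
    proof (rule ccontr)
      assume "P \<noteq> []"
      then have "tail G ` set A \<inter> tail G ` set C = {}" using assms by (simp add: dcuff_def)
      then show False using eqv vA by blast
    qed
    then have one: "tail G ` set A = {v}" "tail G ` set C = {v}" and
      ne: "\<And>d. A = [d] \<Longrightarrow> C \<noteq> [d] \<and> C \<noteq> [dart_opp G d]"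
      using assms eqv by (auto simp: dcuff_def)
    have sing: "\<exists>a. B = [a]" if "distinct (map (tail G) B)" "tail G ` set B = {v}" for B
    proof (cases B)
      case (Cons a B')
      then show ?thesis using that by (cases B') auto
    qed (use that in auto)
    obtain a c where ac: "A = [a]" "C = [c]" using sing[OF A(4) one(1)] sing[OF C(4) one(2)] by blast
    then have "fst a = fst c" "a \<in> darts G S" "c \<in> darts G S" using eq A(1) C(1) by auto
    moreover from this(2) have "length (ends G (fst a)) = 2 \<or> length (ends G (fst a)) = 1"
      by (cases rule: dart_cases) auto
    ultimately have "c = a \<or> c = dart_opp G a"
      by (cases a; cases c) (auto simp: darts_def dart_opp_def)
    then show False using ne ac by auto
  qed
  show ?thesis
    unfolding handcuff_def is_path_def vP vertex_set_closed[OF A(1)] vertex_set_closed[OF C(1)]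
    using negative_figureI[OF A(1,3,4)] negative_figureI[OF C(1,3,4)] neq walkP P(2)
      dcuff_disjointD[OF assms] by simp
qed

text \<open>The rule \<open>half_circle\<close> wants the half edge first; a handcuff with its half
  edge at the other end is reversed.\<close>

lemma dcuff_sym:
  assumes "dcuff v A P w C"
  shows "dcuff w C (wopp P) v A"
proof -
  have P: "dwalk v P w" "distinct (v # map (dart_head G) P)"
    using assms unfolding dcuff_def by blast+
  have D: "set P \<subseteq> darts G S" using dwalk_D[OF P(1)] .
  have heads: "map (dart_head G) (wopp P) = rev (map (tail G) P)"
    using D by (auto simp: wopp_def rev_map tgt_opp)
  have "v # map (dart_head G) P = map (tail G) P @ [w]"
    using P(1) by (induction P arbitrary: v) auto
  then have r: "w # map (dart_head G) (wopp P) = rev (v # map (dart_head G) P)"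
    by (simp add: heads)
  have "distinct (w # map (dart_head G) (wopp P))" unfolding r using P(2) by simp
  moreover have "set (w # map (dart_head G) (wopp P)) = set (v # map (dart_head G) P)"
    unfolding r by simp
  moreover have "\<forall>d. C = [d] \<longrightarrow> A \<noteq> [d] \<and> A \<noteq> [dart_opp G d]" if "P = []"
  proof (intro allI impI)
    fix d assume "C = [d]"
    note that = this \<open>P = []\<close>
    show "A \<noteq> [d] \<and> A \<noteq> [dart_opp G d]"
  proof -
    have "d \<in> darts G S" using assms that by (simp add: dcuff_def)
    then have "dart_opp G (dart_opp G d) = d" by (rule opp_opp)
    moreover have "\<forall>a. A = [a] \<longrightarrow> C \<noteq> [a] \<and> C \<noteq> [dart_opp G a]"
      using assms that(2) by (simp add: dcuff_def)
    ultimately show "A \<noteq> [d] \<and> A \<noteq> [dart_opp G d]" using that(1) by metis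
    qed
  qed
  moreover have "P = [] \<Longrightarrow> v = w" using P(1) by simp
  ultimately show ?thesis
    using assms dwalk_wopp[OF P(1)] dcuff_disjointD[OF assms]
    by (cases "P = []") (simp_all add: dcuff_def Int_commute)
qed

text \<open>The two closed walks are rotations of each other, so their actions are
  conjugate.\<close>

lemma inert_dcuff_sym:
  assumes "dcuff v A P w C" "inert (C @ wopp P @ A @ P)"
  shows "inert (A @ P @ C @ wopp P)"
proof -
  have D: "set P \<subseteq> darts G S" and A: "wsg A = -1"
    using assms(1) dwalk_D by (auto simp: dcuff_def)
  have "act (A @ P @ C @ wopp P) y = y" for y
  proof -
    have "act C (act (wopp P) (act A (act P (act (wopp P) (act A y))))) = act (wopp P) (act A y)"
      using assms(2) by (simp add: inert_def)
    then have "act C (act (wopp P) y) = act (wopp P) (act A y)"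
      by (simp only: act_wopp'[OF D] act_involution[OF A])
    then show ?thesis
      by (simp add: act_wopp'[OF D] act_involution[OF A])
  qed
  then show ?thesis by (simp add: inert_def)
qed

end

section \<open>Hyperbalance and neutral potentials\<close>

lemma handcuff_sign_circuit:
  "handcuff G C1 u P w C2 \<Longrightarrow> sign_circuit G (C1 \<union> walk_edges P \<union> C2)"
  unfolding sign_circuit_def by blast

context gsg_edges
begin

lemma hyperbalanced_circuit_zero:
  "hyperbalanced G S \<Longrightarrow> sign_circuit G C \<Longrightarrow> C \<subseteq> S \<Longrightarrow> circuit_gain G C g \<Longrightarrow> g = 0"
  unfolding hyperbalanced_def neutral_circuit_def by blast

lemma walk_edges_S: "dwalk u W w \<Longrightarrow> fst ` set W \<subseteq> S"
  using dwalk_D[of u W w] by (auto simp: darts_def)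

lemma inert_iff: "wsg W = 1 \<Longrightarrow> inert W \<longleftrightarrow> wgn W = 0"
  by (simp add: inert_def act_def)

text \<open>With half edge gains doubled, the gain of the closed walk is the circuit gain for two
  circles, its negative for a half edge followed by a circle, and -2 times it for two half edges. In
  each case neutrality of the circuit makes it 0.\<close>

lemma dcuff_inert:
  assumes hyper: "hyperbalanced G S" and cuff: "dcuff v A P w C"
  shows "inert (A @ P @ C @ wopp P)"
proof -
  have half_first: "inert (A @ P @ C @ wopp P)"
    if cuff: "dcuff v A P w C" and a: "A = [a]" "half_edge G (fst a)" "snd a = 0"
    for v A P w C a
  proof -
    have C: "dwalk w C w" "wsg C = -1" "distinct (map (tail G) C)"
      and P: "dwalk v P w" "distinct (v # map (dart_head G) P)"
      and A: "dwalk v A v" "wsg A = -1"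
      using cuff unfolding dcuff_def by blast+
    have D: "set P \<subseteq> darts G S" using dwalk_D[OF P(1)] .
    have s: "wsg P * wsg P = 1" using wsg_cases[OF D] by auto
    have linked: "all_links P" using all_links_if_distinct[OF P] .
    have cuff': "handcuff G {fst a} v P w (fst ` set C)"
      using dcuff_handcuff[OF cuff] a by simp
    have wP: "walk_edges P = fst ` set P" by (simp add: walk_edges_def)
    have S: "fst ` set A \<union> walk_edges P \<union> fst ` set C \<subseteq> S"
      using walk_edges_S A(1) C(1) P(1) wP by auto
    have circ: "sign_circuit G ({fst a} \<union> walk_edges P \<union> fst ` set C)"
      using handcuff_sign_circuit[OF cuff'] .
    have l1: "length (ends G (fst a)) = 1" using a(2) by (simp add: half_edge_def)
    have sa: "esign G (fst a) = -1" using A(2) a(1) by (simp add: dart_sign_def)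
    have orient: "tail_sign G a = half_edge_orient G (fst a)"
      using a(3) by (simp add: tail_sign_def half_edge_orient_def)
    have sgn: "wsg (A @ P @ C @ wopp P) = 1" using A(2) C(2) s wsg_wopp[OF D] by auto
    have wgn_append: "wgn (X @ Y) = wgn X + of_int (wsg X) * wgn Y" for X Y
      using act_append[of X Y 0] by (simp add: act_def)
    have ga: "wgn A = - (2 * gain G (fst a) * of_int (half_edge_orient G (fst a)))"
      using a(1) l1 orient by (simp add: dart_gain_def)
    show ?thesis
      using C
    proof (cases rule: simple_negative_figure)
      case (half c)
      have lc: "length (ends G (fst c)) = 1" using half(2) by (simp add: half_edge_def)
      have orientc: "tail_sign G c = half_edge_orient G (fst c)"
        using half(3) by (simp add: tail_sign_def half_edge_orient_def)
      have gc: "wgn C = - (2 * gain G (fst c) * of_int (half_edge_orient G (fst c)))"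
        using half(1) lc orientc by (simp add: dart_gain_def)
      have "circuit_gain G ({fst a} \<union> walk_edges P \<union> {fst c})
          (ultrawalk_gain G (Some (fst a)) P (Some (fst c)))"
        using cuff' half a(2) by (intro circuit_gain.half_half) auto
      then have "ultrawalk_gain G (Some (fst a)) P (Some (fst c)) = 0"
        using hyperbalanced_circuit_zero[OF hyper circ] S a(1) half(1) by auto
      then have "gain G (fst a) * of_int (half_edge_orient G (fst a)) + wgn P
          - gain G (fst c) * of_int (wsg P) * of_int (half_edge_orient G (fst c)) = 0"
        by (simp add: ultrawalk_gain_def walk_gain_eq[OF linked] walk_sign_eq mult.commute)
      moreover have "wgn (A @ P @ C @ wopp P) = - 2 *
          (gain G (fst a) * of_int (half_edge_orient G (fst a)) + wgn P
          - gain G (fst c) * of_int (wsg P) * of_int (half_edge_orient G (fst c)))"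
      proof -
        have "of_int (wsg P) * (of_int (wsg P) * wgn P) = wgn P"
          using wsg_cases[OF D] by auto
        then show ?thesis
          using A(2) C(2) by (simp add: wgn_append ga gc wgn_wopp[OF D] algebra_simps)
      qed
      ultimately show ?thesis using inert_iff[OF sgn] by simp
    next
      case circle
      have "circuit_gain G ({fst a} \<union> walk_edges P \<union> fst ` set C)
          (ultrawalk_gain G (Some (fst a)) (P @ C @ walk_back P) (Some (fst a)))"
        by (rule circuit_gain.half_circle[OF cuff' a(2) circle(3)])
      then have "ultrawalk_gain G (Some (fst a)) (P @ C @ wopp P) (Some (fst a)) = 0"
        using hyperbalanced_circuit_zero[OF hyper circ] S a(1) walk_back_eq[OF linked] by auto
      moreover have "all_links (P @ C @ wopp P)"
        using linked circle(1) by (simp add: all_links_wopp)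
      moreover have "wsg (P @ C @ wopp P) = -1" using C(2) s wsg_wopp[OF D] by simp
      ultimately have "2 * gain G (fst a) * of_int (half_edge_orient G (fst a)) + wgn (P @ C @ wopp P) = 0"
        by (simp add: ultrawalk_gain_def walk_gain_eq walk_sign_eq algebra_simps del: wopp_simps wsg_simps)
      moreover have "wgn (A @ P @ C @ wopp P) = wgn A - wgn (P @ C @ wopp P)"
        by (subst wgn_append) (simp add: A(2))
      ultimately have "wgn (A @ P @ C @ wopp P) = 0"
        unfolding ga by (metis add_uminus_conv_diff minus_add_distrib neg_equal_0_iff_equal)
      then show ?thesis using inert_iff[OF sgn] by simp
    qed
  qed
  have A: "dwalk v A v" "wsg A = -1" "distinct (map (tail G) A)"
    and C: "dwalk w C w" "wsg C = -1" "distinct (map (tail G) C)"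
    and P: "dwalk v P w" "distinct (v # map (dart_head G) P)"
    using cuff unfolding dcuff_def by blast+
  have D: "set P \<subseteq> darts G S" using dwalk_D[OF P(1)] .
  have linked: "all_links P" using all_links_if_distinct[OF P] .
  show ?thesis
    using A
  proof (cases rule: simple_negative_figure)
    case (half a)
    then show ?thesis using half_first[OF cuff] by blast
  next
    case circA: circle
    show ?thesis
      using C
    proof (cases rule: simple_negative_figure)
      case (half c)
      then have "inert (C @ wopp P @ A @ wopp (wopp P))"
        using half_first[OF dcuff_sym[OF cuff]] by blast
      then show ?thesis using inert_dcuff_sym[OF cuff] wopp_wopp[OF D] by simp
    next
      case circC: circle
      have wP: "walk_edges P = fst ` set P" by (simp add: walk_edges_def)
      have S: "fst ` set A \<union> walk_edges P \<union> fst ` set C \<subseteq> S"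
        using walk_edges_S A(1) C(1) P(1) wP by auto
      have cuff': "handcuff G (fst ` set A) v P w (fst ` set C)" using dcuff_handcuff[OF cuff] .
      then have circ: "sign_circuit G (fst ` set A \<union> walk_edges P \<union> fst ` set C)"
        by (rule handcuff_sign_circuit)
      have "circuit_gain G (fst ` set A \<union> walk_edges P \<union> fst ` set C)
          (walk_gain G (A @ P @ C @ walk_back P))"
        by (rule circuit_gain.circle_circle[OF cuff' circA(3) circC(3)])
      then have "walk_gain G (A @ P @ C @ wopp P) = 0"
        using hyperbalanced_circuit_zero[OF hyper circ] S walk_back_eq[OF linked] by auto
      moreover have "all_links (A @ P @ C @ wopp P)"
        using linked circA(1) circC(1) by (simp add: all_links_wopp)
      ultimately have "wgn (A @ P @ C @ wopp P) = 0" by (simp add: walk_gain_eq)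
      moreover have "wsg (A @ P @ C @ wopp P) = 1"
        using A(2) C(2) wsg_cases[OF D] wsg_wopp[OF D] by auto
      ultimately show ?thesis using inert_iff by blast
    qed
  qed
qed

lemma positive_circle_inert:
  assumes hyper: "hyperbalanced G S"
    and W: "dwalk v W v" "W \<noteq> []" "distinct (map (tail G) W)" "wsg W = 1" "\<forall>d. W \<noteq> [d, dart_opp G d]"
  shows "inert W"
proof -
  have linked: "all_links W"
  proof (rule ccontr)
    assume "\<not> ?thesis"
    then obtain a where a: "a \<in> set W" "length (ends G (fst a)) \<noteq> 2" by (auto simp: all_links_def)
    then have Wa: "W = [a]" using half_dart_simple_closed[OF W(1,3)] by blast
    then have "a \<in> darts G S" using W(1) by auto
    then show False
      by (cases rule: dart_cases) (use a(2) Wa W(4) in \<open>auto simp: dart_sign_def\<close>)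
  qed
  have c: "positive_circle G (fst ` set W)"
    using simple_closed_circle[OF W(1-3) linked W(5)] W(4) by (simp add: positive_circle_def)
  then have "circuit_gain G (fst ` set W) (walk_gain G W)"
    using simple_closed_circle(2)[OF W(1-3) linked W(5)] by (rule circuit_gain.circle)
  moreover have "sign_circuit G (fst ` set W)" using c by (simp add: sign_circuit_def)
  ultimately have "walk_gain G W = 0"
    using hyperbalanced_circuit_zero[OF hyper] walk_edges_S[OF W(1)] by blast
  then show ?thesis using inert_iff[OF W(4)] walk_gain_eq[OF linked] by simp
qed

section \<open>Dart conditions as edge equations, and solvability\<close>

lemma link_condition_iff:
  fixes a b g :: 'k
  assumes "t = 1 \<or> t = -1"
  shows "a = - (g * of_int t) + of_int \<sigma> * b \<longleftrightarrow> g + (of_int t * a + of_int (- \<sigma> * t) * b) = 0"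
proof -
  have "g + (of_int t * a + of_int (- \<sigma> * t) * b) = of_int t * (a - (- (g * of_int t) + of_int \<sigma> * b))"
    using assms by (auto simp: algebra_simps)
  then show ?thesis using assms by auto
qed

text \<open>On a link or loop the two conditions differ by the factor t = 1 or -1; on a half edge
  there is an additional factor 2, the price of the doubled gain.\<close>

lemma dart_condition_iff:
  assumes two: "(2::'k) \<noteq> 0" and d: "d \<in> darts G S"
  shows "\<theta> (tail G d) = dart_gain G d + of_int (dart_sign G d) * \<theta> (dart_head G d) \<longleftrightarrow>
    gain G (fst d) + lin G (fst d) \<theta> = 0"
  using d
proof (cases rule: dart_cases)
  case (1 e v t w s)
  then show ?thesis using link_condition_iff[of t "\<theta> v" "gain G e" "esign G e" "\<theta> w"]
    by (simp add: tail_def head_def dart_head_def dart_gain_def dart_sign_def lin_def tail_sign_def)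
next
  case (2 e v t w s)
  then show ?thesis using link_condition_iff[of t "\<theta> v" "gain G e" "esign G e" "\<theta> w"]
    by (simp add: tail_def head_def dart_head_def dart_gain_def dart_sign_def lin_def tail_sign_def
        add.commute)
next
  case (3 e v t)
  have "\<theta> v - (- (2 * gain G e * of_int t) - \<theta> v) = 2 * (\<theta> v + gain G e * of_int t)"
    by (simp add: algebra_simps)
  then have "\<theta> v = - (2 * gain G e * of_int t) - \<theta> v \<longleftrightarrow> 2 * (\<theta> v + gain G e * of_int t) = 0"
    by (metis eq_iff_diff_eq_0)
  also have "\<dots> \<longleftrightarrow> \<theta> v + gain G e * of_int t = 0" unfolding mult_eq_0_iff using two by blast
  also have "\<dots> \<longleftrightarrow> gain G e + of_int t * \<theta> v = 0"
  proof -
    have "gain G e + of_int t * \<theta> v = of_int t * (\<theta> v + gain G e * of_int t)"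
      using 3(5) by (auto simp: algebra_simps)
    then show ?thesis using 3(5) by auto
  qed
  finally show ?thesis
    using 3 by (simp add: tail_def dart_head_def dart_gain_def dart_sign_def lin_def tail_sign_def)
qed

lemma act_potential:
  assumes "\<And>d. d \<in> darts G S \<Longrightarrow> \<theta> (tail G d) = dart_gain G d + of_int (dart_sign G d) * \<theta> (dart_head G d)"
  shows "dwalk u W w \<Longrightarrow> act W (\<theta> w) = \<theta> u"
proof (induction W arbitrary: u)
  case (Cons d W)
  have "act (d # W) (\<theta> w) = act [d] (act W (\<theta> w))" by (rule act_Cons)
  then show ?case using Cons assms[of d] by (simp add: act_def)
qed simp

lemma once_around_dwalk:
  assumes "once_around G C u W" "C \<subseteq> S"
  shows "dwalk u W u" "all_links W" "wsg W = (\<Prod>e\<in>C. esign G e)"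
proof -
  have "walk G u W u" "walk_edges W \<subseteq> S" using assms by (auto simp: once_around_def)
  then show "dwalk u W u" "all_links W" using walk_iff_dwalk[of u W u] by blast+
  have "distinct (map fst W)" "C = fst ` set W" using assms by (auto simp: once_around_def walk_edges_def)
  then show "wsg W = (\<Prod>e\<in>C. esign G e)"
    by (simp add: wsg_def dart_sign_def prod.distinct_set_conv_list distinct_map prod.reindex)
qed

text \<open>A walk of links cannot cover a half edge, so the figure must be a negative
  circle.\<close>

lemma once_around_negative_figure:
  assumes "once_around G C u W" "C \<subseteq> S" "negative_figure G C"
  shows "dwalk u W u" "all_links W" "wsg W = -1"
proof -
  show "dwalk u W u" "all_links W" using once_around_dwalk assms by blast+
  have "\<not> (\<exists>e. half_edge G e \<and> C = {e})"
  proof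
    assume "\<exists>e. half_edge G e \<and> C = {e}"
    then obtain e where e: "half_edge G e" "fst ` set W = {e}"
      using assms(1) by (auto simp: once_around_def walk_edges_def)
    then have "\<exists>d\<in>set W. fst d = e" by blast
    then show False using \<open>all_links W\<close> e(1) by (auto simp: all_links_def half_edge_def)
  qed
  then show "wsg W = -1"
    using assms once_around_dwalk(3) by (auto simp: negative_figure_def negative_circle_def)
qed

theorem hyperbalanced_iff_potential:
  assumes two: "(2::'k) \<noteq> 0"
  shows "hyperbalanced G S \<longleftrightarrow> (\<exists>\<theta>. \<forall>e\<in>S. gain G e + lin G e \<theta> = 0)"
proof
  assume hyper: "hyperbalanced G S"
  have inert: "inert W" if "dwalk u W u" "wsg W = 1" for u W
    by (rule positive_closed_inert[OF positive_circle_inert[OF hyper] dcuff_inert[OF hyper] that])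
  obtain \<theta> where \<theta>: "\<And>d. d \<in> darts G S \<Longrightarrow>
      \<theta> (tail G d) = dart_gain G d + of_int (dart_sign G d) * \<theta> (dart_head G d)"
    using gain_potential[OF two] inert by blast
  have "gain G e + lin G e \<theta> = 0" if e: "e \<in> S" for e
  \<comment> \<open>A loose edge carries no dart; its equation is the neutrality of the one-edge
    circuit.\<close>
  proof (cases "ends G e = []")
    case True
    then have l: "loose_edge G e" using e S_edges by (auto simp: loose_edge_def)
    then have "sign_circuit G {e}" by (auto simp: sign_circuit_def)
    then have "gain G e = 0"
      using hyperbalanced_circuit_zero[OF hyper _ _ circuit_gain.loose[OF l]] e by blast
    then show ?thesis using True by (simp add: lin_def)
  next
    case False
    then have "(e, 0) \<in> darts G S" using e by (simp add: darts_def)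
    then show ?thesis using \<theta> dart_condition_iff[OF two] by fastforce
  qed
  then show "\<exists>\<theta>. \<forall>e\<in>S. gain G e + lin G e \<theta> = 0" by blast
next
  assume "\<exists>\<theta>. \<forall>e\<in>S. gain G e + lin G e \<theta> = 0"
  then obtain \<theta> where \<theta>: "\<And>e. e \<in> S \<Longrightarrow> gain G e + lin G e \<theta> = 0" by blast
  have "\<theta> (tail G d) = dart_gain G d + of_int (dart_sign G d) * \<theta> (dart_head G d)"
    if d: "d \<in> darts G S" for d
    using \<theta>[of "fst d"] dart_condition_iff[OF two d] d by (auto simp: darts_def)
  then have act: "act W (\<theta> w) = \<theta> u" if "dwalk u W w" for u W w
    using act_potential[of \<theta>] that by blast
  \<comment> \<open>For sign 1 the transport equation reads gain + \<theta> u = \<theta> u.\<close>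
  have closed: "walk_gain G W = 0" if "dwalk u W u" "wsg W = 1" "all_links W" for u W
    using act[OF that(1)] that(2) walk_gain_eq[OF that(3)] by (simp add: act_def)
  have halfv: "of_int (half_edge_orient G a) * gain G a = - \<theta> v"
    if "half_edge G a" "a \<in> S" "v \<in> vertex_set G {a}" for a v
  proof -
    have "a \<in> edges G" using that S_edges by blast
    from gsg this show ?thesis
    proof (cases rule: gsg_edge_cases)
      case (2 v' t)
      then show ?thesis using \<theta>[OF that(2)] that(3)
        by (auto simp: lin_def half_edge_orient_def vertex_set_def add_eq_0_iff algebra_simps)
    qed (use that(1) in \<open>auto simp: half_edge_def\<close>)
  qed
  show "hyperbalanced G S"
    unfolding hyperbalanced_def neutral_circuit_def
  proof (intro allI impI)
    fix C g assume CS: "C \<subseteq> S" and "circuit_gain G C g"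
    from this(2) CS show "g = 0"
    proof (cases rule: circuit_gain.cases)
      case (loose e)
      then show ?thesis using \<theta>[of e] CS by (auto simp: loose_edge_def lin_def)
    next
      case (circle u W)
      then show ?thesis using once_around_dwalk[OF circle(3) CS] closed by (auto simp: positive_circle_def)
    next
      case (circle_circle C1 u P w C2 W1 W2)
      have C: "C1 \<subseteq> S" "C2 \<subseteq> S" "walk_edges P \<subseteq> S" using circle_circle(1) CS by auto
      have nf: "negative_figure G C1" "negative_figure G C2" and wP: "walk G u P w"
        using circle_circle(3) by (auto simp: handcuff_def is_path_def)
      have P: "dwalk u P w" "all_links P" using walk_iff_dwalk[of u P w] wP C(3) by blast+
      note W1 = once_around_negative_figure[OF circle_circle(4) C(1) nf(1)]
      note W2 = once_around_negative_figure[OF circle_circle(5) C(2) nf(2)]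
      have D: "set P \<subseteq> darts G S" using dwalk_D P(1) by blast
      have "dwalk u (W1 @ P @ W2 @ wopp P) u"
        using W1(1) W2(1) P(1) dwalk_wopp[OF P(1)] by (auto simp: dwalk_append)
      moreover have "wsg (W1 @ P @ W2 @ wopp P) = 1"
        using W1 W2 wsg_wopp[OF D] wsg_cases[OF D] by auto
      ultimately show ?thesis
        using closed W1(2) W2(2) P(2) circle_circle(2) walk_back_eq[OF P(2)] by (simp add: all_links_wopp)
    next
      case (half_circle a u P w C2 W2)
      have C: "a \<in> S" "C2 \<subseteq> S" "walk_edges P \<subseteq> S" using half_circle(1) CS by auto
      have nf: "negative_figure G C2" and wP: "walk G u P w"
        using half_circle(3) by (auto simp: handcuff_def is_path_def)
      have u: "u \<in> vertex_set G {a}"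
        using half_circle(3) unfolding handcuff_def by (auto split: if_splits)
      have P: "dwalk u P w" "all_links P" using walk_iff_dwalk[of u P w] wP C(3) by blast+
      note W2 = once_around_negative_figure[OF half_circle(5) C(2) nf]
      have D: "set P \<subseteq> darts G S" using dwalk_D P(1) by blast
      have "dwalk u (P @ W2 @ wopp P) u"
        using W2(1) P(1) dwalk_wopp[OF P(1)] by (auto simp: dwalk_append)
      moreover have s: "wsg (P @ W2 @ wopp P) = -1"
        using W2 wsg_wopp[OF D] wsg_cases[OF D] by auto
      \<comment> \<open>For sign -1 transport gives twice the potential, which cancels against the
        half edge counted at both ends of the ultrawalk.\<close>
      ultimately have "wgn (P @ W2 @ wopp P) = 2 * \<theta> u"
        using act[of u "P @ W2 @ wopp P" u] by (simp only: act_def) (simp add: algebra_simps)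
      then have "walk_gain G (P @ W2 @ walk_back P) = 2 * \<theta> u"
        using walk_gain_eq[of "P @ W2 @ wopp P"] walk_back_eq[OF P(2)] P(2) W2(2) by (simp add: all_links_wopp)
      moreover have "walk_sign G (P @ W2 @ walk_back P) = -1"
        using s walk_sign_eq walk_back_eq[OF P(2)] by simp
      ultimately have "g = of_int (half_edge_orient G a) * gain G a + 2 * \<theta> u + of_int (half_edge_orient G a) * gain G a"
        using half_circle(2) by (simp add: ultrawalk_gain_def mult.commute)
      then show ?thesis using halfv[OF half_circle(4) C(1) u] by simp
    next
      case (half_half a u P w b)
      have C: "a \<in> S" "b \<in> S" "walk_edges P \<subseteq> S" using half_half(1) CS by auto
      have wP: "walk G u P w"
        using half_half(3) by (auto simp: handcuff_def is_path_def)
      have u: "u \<in> vertex_set G {a}"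
        using half_half(3) unfolding handcuff_def by (auto split: if_splits)
      have "w \<in> vertex_set G {b}"
      proof (cases "P = []")
        case True
        then have "u = w" using wP by simp
        then show ?thesis using half_half(3) True unfolding handcuff_def by auto
      next
        case False
        then show ?thesis using half_half(3) unfolding handcuff_def by auto
      qed
      note b = halfv[OF half_half(5) C(2) this]
      have P: "dwalk u P w" "all_links P" using walk_iff_dwalk[of u P w] wP C(3) by blast+
      have "g = of_int (half_edge_orient G a) * gain G a + wgn P - of_int (wsg P) * (of_int (half_edge_orient G b) * gain G b)"
        using half_half(2) by (simp add: ultrawalk_gain_def walk_gain_eq[OF P(2)] walk_sign_eq mult.commute mult.left_commute)
      \<comment> \<open>Each half edge determines the potential at its vertex, so the ultrawalk gain
        is the defect of transport along \<open>P\<close>.\<close>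
      then have "g = act P (\<theta> w) - \<theta> u"
        unfolding halfv[OF half_half(4) C(1) u] b by (simp add: act_def)
      then show ?thesis using act[OF P(1)] by simp
    qed
  qed
qed

end

section \<open>Sign balance and the kernel of the signed incidence map\<close>

lemma lin_cong:
  assumes "is_gain_signed_graph G" "e \<in> edges G" "\<And>v. v \<in> verts G \<Longrightarrow> \<theta> v = \<theta>' v"
  shows "lin G e \<theta> = lin G e \<theta>'"
  using assms(1,2) by (cases rule: gsg_edge_cases) (auto simp: lin_def assms(3))

lemma lin_add: "lin G e (\<lambda>v. \<theta> v + \<theta>' v) = lin G e \<theta> + lin G e \<theta>'"
proof -
  have "(\<Sum>(v, t)\<leftarrow>xs. of_int t * (\<theta> v + \<theta>' v)) =
    (\<Sum>(v, t)\<leftarrow>xs. of_int t * \<theta> v) + (\<Sum>(v, t)\<leftarrow>xs. of_int t * \<theta>' v)" for xs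
    by (induction xs) (auto simp: algebra_simps)
  then show ?thesis by (simp add: lin_def)
qed

text \<open>Serves a double count: multiplying vertex signs over all edge ends of a circle gives
  each vertex its degree as exponent.\<close>

lemma prod_power_count:
  fixes f :: "'a \<Rightarrow> int"
  assumes "finite V" "fst ` set xs \<subseteq> V"
  shows "(\<Prod>x\<in>V. f x ^ length (filter (\<lambda>p. fst p = x) xs)) = (\<Prod>p\<leftarrow>xs. f (fst p))"
  using assms(2)
proof (induction xs)
  case (Cons p xs)
  have "(\<Prod>x\<in>V. f x ^ length (filter (\<lambda>p. fst p = x) (p # xs))) =
    (\<Prod>x\<in>V. (if fst p = x then f x else 1) * f x ^ length (filter (\<lambda>p. fst p = x) xs))"
    by (intro prod.cong) auto
  also have "\<dots> = f (fst p) * (\<Prod>p\<leftarrow>xs. f (fst p))"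
    using Cons assms(1) by (simp add: prod.distrib)
  finally show ?case by simp
qed simp

context gsg_edges
begin

lemma finite_verts: "finite (verts G)"
  using gsg by (simp add: is_gain_signed_graph_def)

lemma negative_figure_not_balanced:
  "negative_figure G C \<Longrightarrow> C \<subseteq> S \<Longrightarrow> \<not> sign_balanced G S"
  by (auto simp: negative_figure_def sign_balanced_def)

text \<open>A negative closed walk contains a negative figure, so balance permits
  \<open>sign_potential\<close>. Conversely, \<eta> rules out half edges and writes the sign of an
  edge from v to w as \<eta> v * \<eta> w; around a circle every vertex occurs twice, so the product
  is 1.\<close>

theorem sign_balanced_iff:
  "sign_balanced G S \<longleftrightarrow>
    (\<exists>\<eta> :: 'v \<Rightarrow> int. (\<forall>v\<in>verts G. \<eta> v = 1 \<or> \<eta> v = -1) \<and> (\<forall>e\<in>S. lin G e \<eta> = 0))"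
proof
  assume bal: "sign_balanced G S"
  have "wsg W = 1" if W: "dwalk u W u" for u W
  proof (rule ccontr)
    assume "wsg W \<noteq> 1"
    then have "wsg W = -1" using wsg_cases dwalk_D[OF W] by blast
    then obtain v C where C: "dwalk v C v" "wsg C = -1" "distinct (map (tail G) C)"
      using negative_closed_dwalk_simple[OF W] by blast
    then show False
      using negative_figure_not_balanced[OF negative_figureI[OF C] walk_edges_S[OF C(1)]] bal by blast
  qed
  then obtain \<eta> where \<eta>: "\<And>v. \<eta> v \<in> {1, -1}"
    "\<And>d. d \<in> darts G S \<Longrightarrow> \<eta> (tail G d) = dart_sign G d * \<eta> (dart_head G d)"
    using sign_potential by blast
  have "lin G e \<eta> = 0" if e: "e \<in> S" for e
  proof -
    have eE: "e \<in> edges G" using e S_edges by blast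
    from gsg eE show ?thesis
    proof (cases rule: gsg_edge_cases)
      case (1 v t w s)
      then have "(e, 0) \<in> darts G S" using e by (simp add: darts_def)
      from \<eta>(2)[OF this] have "\<eta> v = esign G e * \<eta> w"
        using 1 by (simp add: tail_def dart_head_def dart_sign_def head_def)
      then show ?thesis using 1 by (simp add: lin_def)
    next
      case 2
      then show ?thesis using bal e by (auto simp: sign_balanced_def)
    next
      case 3
      then show ?thesis by (simp add: lin_def)
    qed
  qed
  then show "\<exists>\<eta> :: 'v \<Rightarrow> int. (\<forall>v\<in>verts G. \<eta> v = 1 \<or> \<eta> v = -1) \<and> (\<forall>e\<in>S. lin G e \<eta> = 0)"
    using \<eta>(1) by blast
next
  assume "\<exists>\<eta> :: 'v \<Rightarrow> int. (\<forall>v\<in>verts G. \<eta> v = 1 \<or> \<eta> v = -1) \<and> (\<forall>e\<in>S. lin G e \<eta> = 0)"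
  then obtain \<eta> :: "'v \<Rightarrow> int" where \<eta>: "\<And>v. v \<in> verts G \<Longrightarrow> \<eta> v = 1 \<or> \<eta> v = -1"
    "\<And>e. e \<in> S \<Longrightarrow> lin G e \<eta> = 0" by blast
  have "\<not> half_edge G e" if e: "e \<in> S" for e
  proof
    assume h: "half_edge G e"
    have "e \<in> edges G" using e S_edges by blast
    from gsg this show False
    proof (cases rule: gsg_edge_cases)
      case (2 v t)
      then show False using \<eta>(1)[of v] \<eta>(2)[OF e] by (auto simp: lin_def)
    qed (use h in \<open>auto simp: half_edge_def\<close>)
  qed
  moreover have "\<not> negative_circle G C" if C: "C \<subseteq> S" for C
  proof
    assume neg: "negative_circle G C"
    then have circ: "circle G C" by (simp add: negative_circle_def)
    have ends: "fst ` set (ends G e) \<subseteq> verts G" if "e \<in> C" for e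
      using gsg that C S_edges unfolding is_gain_signed_graph_def by fastforce
    have "esign G e = (\<Prod>p\<leftarrow>ends G e. \<eta> (fst p))" if e: "e \<in> C" for e
    proof -
      have l: "link_or_loop G e" using circ e by (simp add: circle_def)
      have "e \<in> edges G" using e C S_edges by blast
      from gsg this show ?thesis
      proof (cases rule: gsg_edge_cases)
        case (1 v t w s)
        then show ?thesis using \<eta>(1)[of v] \<eta>(1)[of w] \<eta>(2)[of e] e C by (auto simp: lin_def)
      qed (use l in \<open>auto simp: link_or_loop_def\<close>)
    qed
    then have "(\<Prod>e\<in>C. esign G e) = (\<Prod>e\<in>C. \<Prod>x\<in>verts G. \<eta> x ^ length (filter (\<lambda>p. fst p = x) (ends G e)))"
      using prod_power_count[OF finite_verts ends] by (intro prod.cong) auto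
    also have "\<dots> = (\<Prod>x\<in>verts G. \<eta> x ^ degree_in G C x)"
      by (subst prod.swap) (simp add: degree_in_def power_sum)
    also have "\<dots> = 1"
    proof (intro prod.neutral ballI)
      fix x assume x: "x \<in> verts G"
      show "\<eta> x ^ degree_in G C x = 1"
      proof (cases "x \<in> vertex_set G C")
        case True
        then have "degree_in G C x = 2" using circ by (simp add: circle_def)
        then show ?thesis using \<eta>(1)[OF x] by auto
      next
        case False
        then have "degree_in G C x = 0"
          unfolding degree_in_def vertex_set_def by (force simp: filter_empty_conv intro!: sum.neutral)
        then show ?thesis by simp
      qed
    qed
    finally show False using neg by (simp add: negative_circle_def)
  qed
  ultimately show "sign_balanced G S" by (simp add: sign_balanced_def)
qed

section \<open>Components and positive switchers\<close>

lemma connected_by_iff: "connected_by G S u w \<longleftrightarrow> u \<in> verts G \<and> (\<exists>W. dwalk u W w \<and> all_links W)"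
  unfolding connected_by_def using walk_iff_dwalk by blast

lemma dwalk_end_verts: "dwalk u W w \<Longrightarrow> u \<in> verts G \<Longrightarrow> w \<in> verts G"
  by (induction W arbitrary: u) (use dart_verts in auto)

lemma connected_by_sym: "connected_by G S u w \<Longrightarrow> connected_by G S w u"
  unfolding connected_by_iff using dwalk_wopp all_links_wopp dwalk_end_verts by blast

lemma connected_by_trans: "connected_by G S u v \<Longrightarrow> connected_by G S v w \<Longrightarrow> connected_by G S u w"
  unfolding connected_by_iff using dwalk_append all_links_simps(3) by blast

lemma connected_by_refl: "u \<in> verts G \<Longrightarrow> connected_by G S u u"
  unfolding connected_by_iff by (auto intro: exI[of _ "[]"])

lemma component_of_self: "v \<in> verts G \<Longrightarrow> v \<in> component_of G S v"
  using connected_by_refl by (simp add: component_of_def)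

lemma component_of_eq: "connected_by G S u w \<Longrightarrow> component_of G S u = component_of G S w"
  unfolding component_of_def using connected_by_sym connected_by_trans by blast

lemma mem_component_of: "w \<in> component_of G S v \<Longrightarrow> component_of G S w = component_of G S v"
  using component_of_eq by (auto simp: component_of_def)

lemma link_component:
  assumes "e \<in> S" "ends G e = [(v, t), (w, s)]"
  shows "component_of G S v = component_of G S w"
proof -
  have d: "(e, 0) \<in> darts G S" using assms by (simp add: darts_def)
  have "v \<in> verts G" using dart_verts[OF d] assms by (simp add: tail_def)
  moreover have "dwalk v [(e, 0)] w" "all_links [(e, 0)]"
    using d assms by (auto simp: tail_def dart_head_def head_def)
  ultimately have "connected_by G S v w" unfolding connected_by_iff by blast
  then show ?thesis by (rule component_of_eq)
qed

lemma component_edges_ends: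
  assumes "e \<in> S" "(v, t) \<in> set (ends G e)"
  shows "e \<in> component_edges G S (component_of G S v)"
proof -
  have "e \<in> edges G" using assms S_edges by blast
  from gsg this show ?thesis
  proof (cases rule: gsg_edge_cases)
    case (1 v' t' w s)
    then have "component_of G S v' = component_of G S w" using link_component assms by blast
    then show ?thesis using 1 assms component_of_self by (fastforce simp: component_edges_def)
  next
    case (2 v' t')
    then show ?thesis using assms component_of_self by (auto simp: component_edges_def)
  qed (use assms in auto)
qed

lemma component_edges_gsg: "gsg_edges G (component_edges G S B)"
  using gsg S_edges by (unfold_locales) (auto simp: component_edges_def)

text \<open>On one block a sign potential \<eta> is already a switcher, since its kernel equation
  says that \<eta> v * \<eta> w is the edge sign. Distinct blocks are disjoint, so these potentials
  glue.\<close>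

lemma ex_positive_switcher: "\<exists>\<zeta>. positive_switcher G S \<zeta>"
proof -
  have "\<forall>B\<in>balanced_blocks G S. \<exists>\<eta> :: 'v \<Rightarrow> int. (\<forall>v\<in>verts G. \<eta> v = 1 \<or> \<eta> v = -1) \<and>
      (\<forall>e\<in>component_edges G S B. lin G e \<eta> = 0)"
    using gsg_edges.sign_balanced_iff[OF component_edges_gsg] by (auto simp: balanced_blocks_def)
  then obtain \<eta> :: "'v set \<Rightarrow> 'v \<Rightarrow> int" where
    \<eta>: "\<And>B v. B \<in> balanced_blocks G S \<Longrightarrow> v \<in> verts G \<Longrightarrow> \<eta> B v = 1 \<or> \<eta> B v = -1"
    "\<And>B e. B \<in> balanced_blocks G S \<Longrightarrow> e \<in> component_edges G S B \<Longrightarrow> lin G e (\<eta> B) = 0"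
    by metis
  define \<zeta> where "\<zeta> v = (if component_of G S v \<in> balanced_blocks G S then \<eta> (component_of G S v) v else 1)" for v
  have "esign (sign_switch \<zeta> G) e = 1"
    if B: "B \<in> balanced_blocks G S" and e: "e \<in> component_edges G S B" for B e
  proof -
    have eS: "e \<in> S" "ends G e \<noteq> []" "fst ` set (ends G e) \<subseteq> B" using e by (auto simp: component_edges_def)
    have \<zeta>: "\<zeta> v = \<eta> B v" if "v \<in> B" for v
    proof -
      obtain u where "B = component_of G S u" using B by (auto simp: balanced_blocks_def)
      then have "component_of G S v = B" using mem_component_of that by blast
      then show ?thesis using B by (simp add: \<zeta>_def)
    qed
    have "e \<in> edges G" using eS S_edges by blast
    from gsg this show ?thesis
    proof (cases rule: gsg_edge_cases)
      case (1 v t w s)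
      then show ?thesis
        using \<eta>(1)[OF B, of v] \<eta>(1)[OF B, of w] \<eta>(2)[OF B e] \<zeta>[of v] \<zeta>[of w] eS
        by (auto simp: sign_switch_def lin_def)
    next
      case (2 v t)
      then show ?thesis using \<eta>(1)[OF B, of v] \<eta>(2)[OF B e] by (auto simp: lin_def)
    qed (use eS in auto)
  qed
  moreover have "\<zeta> v \<in> {1, -1}" if "v \<in> verts G" for v using \<eta>(1) that by (auto simp: \<zeta>_def)
  ultimately show ?thesis unfolding positive_switcher_def by blast
qed

section \<open>Kernel elements on balanced and unbalanced components\<close>

lemma kernel_dart:
  fixes \<theta> :: "'v \<Rightarrow> 'r::comm_ring_1"
  assumes "d \<in> darts G S" "length (ends G (fst d)) = 2" "lin G (fst d) \<theta> = 0"
  shows "\<theta> (tail G d) = of_int (esign G (fst d)) * \<theta> (dart_head G d)"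
proof -
  have *: "a = of_int \<sigma> * b"
    if t: "t = 1 \<or> t = -1" and z: "of_int t * a + of_int (- \<sigma> * t) * b = 0" for a b :: 'r and t \<sigma>
  proof -
    have "a - of_int \<sigma> * b = of_int t * (of_int t * a + of_int (- \<sigma> * t) * b)"
      using t by (auto simp: algebra_simps)
    then show ?thesis using z by simp
  qed
  show ?thesis
    using assms(1)
  proof (cases rule: dart_cases)
    case (1 e v t w s)
    then show ?thesis using assms(3) *[of t "\<theta> v" "esign G e" "\<theta> w"]
      by (simp add: lin_def tail_def head_def dart_head_def)
  next
    case (2 e v t w s)
    then show ?thesis using assms(3) *[of t "\<theta> v" "esign G e" "\<theta> w"]
      by (simp add: lin_def tail_def head_def dart_head_def add.commute)
  qed (use assms(2) in auto)
qed

lemma kernel_connected: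
  fixes \<theta> :: "'v \<Rightarrow> 'r::comm_ring_1"
  assumes "\<And>e. e \<in> S \<Longrightarrow> lin G e \<theta> = 0"
  shows "dwalk u W w \<Longrightarrow> all_links W \<Longrightarrow> \<theta> u = \<theta> w \<or> \<theta> u = - \<theta> w"
proof (induction W arbitrary: u)
  case (Cons d W)
  have d: "d \<in> darts G S" "length (ends G (fst d)) = 2" using Cons.prems by auto
  have l: "lin G (fst d) \<theta> = 0" using assms d by (simp add: darts_def)
  have "\<theta> (tail G d) = \<theta> (dart_head G d) \<or> \<theta> (tail G d) = - \<theta> (dart_head G d)"
    using kernel_dart[OF d l] sg_cases[OF d(1)] by (auto simp: dart_sign_def)
  then show ?case using Cons.IH[of "dart_head G d"] Cons.prems by auto
qed simp

text \<open>A nonzero value spreads over its component up to sign, and the signs relative to it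
  would form a sign potential, making the component balanced.\<close>

lemma kernel_unbalanced:
  fixes \<theta> :: "'v \<Rightarrow> 'r::idom"
  assumes two: "(2::'r) \<noteq> 0" and ker: "\<And>e. e \<in> S \<Longrightarrow> lin G e \<theta> = 0"
    and v: "v \<in> verts G" "component_of G S v \<notin> balanced_blocks G S"
  shows "\<theta> v = 0"
proof (rule ccontr)
  assume a: "\<theta> v \<noteq> 0"
  define \<eta> :: "'v \<Rightarrow> int" where "\<eta> x = (if \<theta> x = \<theta> v then 1 else -1)" for x
  have \<theta>: "\<theta> x = of_int (\<eta> x) * \<theta> v" if "x \<in> component_of G S v" for x
  proof -
    have "connected_by G S x v" using that connected_by_sym by (auto simp: component_of_def)
    then show ?thesis using kernel_connected[OF ker] unfolding connected_by_iff \<eta>_def by auto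
  qed
  have "lin G e \<eta> = 0" if e: "e \<in> component_edges G S (component_of G S v)" for e
  proof -
    have eS: "e \<in> S" "fst ` set (ends G e) \<subseteq> component_of G S v" using e by (auto simp: component_edges_def)
    have eE: "e \<in> edges G" using eS S_edges by blast
    have "(\<Sum>(x, t)\<leftarrow>xs. of_int t * \<theta> x) = of_int (\<Sum>(x, t)\<leftarrow>xs. t * \<eta> x) * \<theta> v"
      if "fst ` set xs \<subseteq> component_of G S v" for xs
      using that by (induction xs) (auto simp: \<theta> algebra_simps)
    then have "of_int (lin G e \<eta>) * \<theta> v = 0" using ker[OF eS(1)] eS(2) by (simp add: lin_def)
    then have z: "(of_int (lin G e \<eta>) :: 'r) = 0" using a by simp
    \<comment> \<open>At most two terms of absolute value 1 occur, so once the image of the sum in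
      the domain is 0, the integer itself is 0, as 1 and 2 are nonzero there.\<close>
    have "lin G e \<eta> \<in> {-2, -1, 0, 1, 2}"
      using gsg eE by (cases rule: gsg_edge_cases) (auto simp: lin_def \<eta>_def)
    then show ?thesis using z two by auto
  qed
  then have "sign_balanced G (component_edges G S (component_of G S v))"
    unfolding gsg_edges.sign_balanced_iff[OF component_edges_gsg]
    by (intro exI[of _ \<eta>]) (auto simp: \<eta>_def)
  then show False using v by (auto simp: balanced_blocks_def)
qed

end

locale gsg_switched = gsg_edges +
  fixes \<zeta> :: "'a \<Rightarrow> int"
  assumes switcher: "positive_switcher G S \<zeta>"
begin

lemma \<zeta>_cases: "v \<in> verts G \<Longrightarrow> \<zeta> v = 1 \<or> \<zeta> v = -1"
  using switcher by (auto simp: positive_switcher_def)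

text \<open>The functions in the kernel of the signed incidence map of \<open>S\<close> are, after switching,
  constant on the sign-balanced blocks and zero elsewhere.\<close>

definition expand :: "('a set \<Rightarrow> 'r::comm_ring_1) \<Rightarrow> 'a \<Rightarrow> 'r" where
  "expand \<psi> v = (if component_of G S v \<in> balanced_blocks G S
     then of_int (\<zeta> v) * \<psi> (component_of G S v) else 0)"

lemma switched_edge_positive:
  assumes "e \<in> S" "(v, t) \<in> set (ends G e)" "component_of G S v \<in> balanced_blocks G S"
  shows "esign (sign_switch \<zeta> G) e = 1"
  using switcher component_edges_ends[OF assms(1,2)] assms(3) unfolding positive_switcher_def by blast

text \<open>In a balanced block the edge sign is \<zeta> v * \<zeta> w, so the two end terms cancel;
  a half edge of S never meets a balanced block.\<close>

lemma lin_expand_S: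
  assumes e: "e \<in> S"
  shows "lin G e (expand \<psi>) = 0"
proof -
  have "e \<in> edges G" using e S_edges by blast
  from gsg this show ?thesis
  proof (cases rule: gsg_edge_cases)
    case (1 v t w s)
    have c: "component_of G S v = component_of G S w" using link_component[OF e 1(1)] .
    show ?thesis
    proof (cases "component_of G S v \<in> balanced_blocks G S")
      case True
      have "\<zeta> v * esign G e * \<zeta> w = 1"
        using switched_edge_positive[OF e _ True] 1 by (auto simp: sign_switch_def)
      then have "esign G e = \<zeta> v * \<zeta> w" using \<zeta>_cases[OF 1(2)] \<zeta>_cases[OF 1(3)] by auto
      then show ?thesis using 1 c True \<zeta>_cases[OF 1(2)] \<zeta>_cases[OF 1(3)]
        by (auto simp: lin_def expand_def)
    qed (use 1 c in \<open>simp add: lin_def expand_def\<close>)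
  next
    case (2 v t)
    have "component_of G S v \<notin> balanced_blocks G S"
      using switched_edge_positive[OF e, of v t] 2 by (auto simp: sign_switch_def)
    then show ?thesis using 2 by (simp add: lin_def expand_def)
  qed (simp add: lin_def)
qed

lemma kernel_switched_const:
  fixes \<theta> :: "'a \<Rightarrow> 'r::comm_ring_1"
  assumes ker: "\<And>e. e \<in> S \<Longrightarrow> lin G e \<theta> = 0"
    and bal: "component_of G S u \<in> balanced_blocks G S"
  shows "dwalk u W w \<Longrightarrow> all_links W \<Longrightarrow> of_int (\<zeta> u) * \<theta> u = of_int (\<zeta> w) * \<theta> w"
  using bal
proof (induction W arbitrary: u)
  case (Cons d W)
  have d: "d \<in> darts G S" "length (ends G (fst d)) = 2" using Cons.prems by auto
  have u: "u = tail G d" "u \<in> verts G" using Cons.prems dart_verts[OF d(1)] by auto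
  have "dwalk u [d] (dart_head G d)" "all_links [d]" using Cons.prems by auto
  then have "connected_by G S u (dart_head G d)"
    unfolding connected_by_iff using u(2) by blast
  then have c: "component_of G S u = component_of G S (dart_head G d)" by (rule component_of_eq)
  have l: "lin G (fst d) \<theta> = 0" using ker d by (simp add: darts_def)
  have z: "\<zeta> (tail G d) = 1 \<or> \<zeta> (tail G d) = -1" "\<zeta> (dart_head G d) = 1 \<or> \<zeta> (dart_head G d) = -1"
    using dart_verts[OF d(1)] \<zeta>_cases by auto
  have "\<zeta> (tail G d) * esign G (fst d) * \<zeta> (dart_head G d) = 1"
    using d(1)
  proof (cases rule: dart_cases)
    case (1 e v t w s)
    then show ?thesis
      using switched_edge_positive[of e v t] Cons.prems(3) u
      by (auto simp: sign_switch_def tail_def head_def dart_head_def)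
  next
    case (2 e v t w s)
    then show ?thesis
      using switched_edge_positive[of e v t] Cons.prems(3) u
      by (auto simp: sign_switch_def tail_def head_def dart_head_def mult.commute mult.left_commute)
  qed (use d in auto)
  then have "esign G (fst d) = \<zeta> (tail G d) * \<zeta> (dart_head G d)" using z by auto
  then have "of_int (\<zeta> (tail G d)) * \<theta> (tail G d) = of_int (\<zeta> (dart_head G d)) * \<theta> (dart_head G d)"
    using kernel_dart[OF d l] z by auto
  then show ?case using Cons.IH[of "dart_head G d"] Cons.prems c by auto
qed simp

text \<open>Stated over an arbitrary domain because it serves twice: over the integers for counting
  and over K for the gain equations. \<open>\<psi>\<close> samples the switched function at an
  arbitrary representative of each block.\<close>

lemma kernel_expand:
  fixes \<theta> :: "'a \<Rightarrow> 'r::idom"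
  assumes two: "(2::'r) \<noteq> 0" and ker: "\<And>e. e \<in> S \<Longrightarrow> lin G e \<theta> = 0"
    and v: "v \<in> verts G"
  defines "\<psi> \<equiv> \<lambda>B. of_int (\<zeta> (SOME x. x \<in> B)) * \<theta> (SOME x. x \<in> B)"
  shows "expand \<psi> v = \<theta> v"
proof (cases "component_of G S v \<in> balanced_blocks G S")
  case True
  define r where "r = (SOME x. x \<in> component_of G S v)"
  have "r \<in> component_of G S v"
    unfolding r_def using component_of_self[OF v] by (rule someI)
  then have "connected_by G S v r" by (simp add: component_of_def)
  then have "of_int (\<zeta> v) * \<theta> v = of_int (\<zeta> r) * \<theta> r"
    using kernel_switched_const[OF ker True] unfolding connected_by_iff by blast
  then have "expand \<psi> v = of_int (\<zeta> v) * (of_int (\<zeta> v) * \<theta> v)"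
    using True by (simp add: expand_def \<psi>_def r_def)
  then show ?thesis using \<zeta>_cases[OF v] by auto
next
  case False
  then show ?thesis using kernel_unbalanced[OF two ker] v by (simp add: expand_def)
qed

text \<open>The value set contains 0 for the vertices outside balanced blocks and is closed under
  negation, as multiplication by \<zeta> demands.\<close>

lemma kernel_bij:
  "bij_betw (\<lambda>\<psi>. restrict (expand \<psi>) (verts G))
    (balanced_blocks G S \<rightarrow>\<^sub>E {-1, 0, 1 :: int})
    {\<theta> \<in> verts G \<rightarrow>\<^sub>E {-1, 0, 1}. \<forall>e\<in>S. lin G e \<theta> = 0}"
proof (rule bij_betw_imageI)
  show "inj_on (\<lambda>\<psi>. restrict (expand \<psi>) (verts G)) (balanced_blocks G S \<rightarrow>\<^sub>E {-1, 0, 1 :: int})"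
  proof (rule inj_onI)
    fix \<psi> \<psi>' :: "'a set \<Rightarrow> int"
    assume a: "\<psi> \<in> balanced_blocks G S \<rightarrow>\<^sub>E {-1, 0, 1}" "\<psi>' \<in> balanced_blocks G S \<rightarrow>\<^sub>E {-1, 0, 1}"
      "restrict (expand \<psi>) (verts G) = restrict (expand \<psi>') (verts G)"
    show "\<psi> = \<psi>'"
    proof (rule PiE_ext[OF a(1,2)])
      fix B assume B: "B \<in> balanced_blocks G S"
      then obtain v where v: "v \<in> verts G" "B = component_of G S v" by (auto simp: balanced_blocks_def)
      have "expand \<psi> v = expand \<psi>' v" using fun_cong[OF a(3), of v] v by simp
      then show "\<psi> B = \<psi>' B" using v B \<zeta>_cases[OF v(1)] by (auto simp: expand_def)
    qed
  qed
  show "(\<lambda>\<psi>. restrict (expand \<psi>) (verts G)) ` (balanced_blocks G S \<rightarrow>\<^sub>E {-1, 0, 1 :: int}) =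
    {\<theta> \<in> verts G \<rightarrow>\<^sub>E {-1, 0, 1}. \<forall>e\<in>S. lin G e \<theta> = 0}"
  proof (intro equalityI subsetI)
    fix \<theta> assume "\<theta> \<in> (\<lambda>\<psi>. restrict (expand \<psi>) (verts G)) ` (balanced_blocks G S \<rightarrow>\<^sub>E {-1, 0, 1 :: int})"
    then obtain \<psi> where \<psi>: "\<psi> \<in> balanced_blocks G S \<rightarrow>\<^sub>E {-1, 0, 1 :: int}"
      "\<theta> = restrict (expand \<psi>) (verts G)" by blast
    have "lin G e \<theta> = 0" if "e \<in> S" for e
      using lin_expand_S[OF that, of \<psi>] lin_cong[OF gsg, of e \<theta> "expand \<psi>"] that S_edges \<psi>(2) by auto
    moreover have "expand \<psi> v \<in> {-1, 0, 1}" if v: "v \<in> verts G" for v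
      using PiE_mem[OF \<psi>(1), of "component_of G S v"] \<zeta>_cases[OF v] by (auto simp: expand_def)
    ultimately show "\<theta> \<in> {\<theta> \<in> verts G \<rightarrow>\<^sub>E {-1, 0, 1}. \<forall>e\<in>S. lin G e \<theta> = 0}"
      using \<psi>(2) by auto
  next
    fix \<theta> assume "\<theta> \<in> {\<theta> \<in> verts G \<rightarrow>\<^sub>E {-1, 0, 1 :: int}. \<forall>e\<in>S. lin G e \<theta> = 0}"
    then have \<theta>: "\<theta> \<in> verts G \<rightarrow>\<^sub>E {-1, 0, 1}" "\<And>e. e \<in> S \<Longrightarrow> lin G e \<theta> = 0" by auto
    define \<psi>0 where "\<psi>0 B = of_int (\<zeta> (SOME x. x \<in> B)) * \<theta> (SOME x. x \<in> B)" for B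
    \<comment> \<open>The restriction makes the function extensional, as the function space
      requires; \<open>expand\<close> reads only values at blocks.\<close>
    define \<psi> where "\<psi> = restrict \<psi>0 (balanced_blocks G S)"
    have ex: "expand \<psi> v = \<theta> v" if "v \<in> verts G" for v
      using kernel_expand[of \<theta>, OF _ \<theta>(2) that]
      by (cases "component_of G S v \<in> balanced_blocks G S")
        (simp_all add: expand_def \<psi>_def \<psi>0_def[abs_def])
    have "\<psi> B \<in> {-1, 0, 1}" if B: "B \<in> balanced_blocks G S" for B
    proof -
      obtain v where v: "v \<in> verts G" "B = component_of G S v" using B by (auto simp: balanced_blocks_def)
      have "\<theta> v \<in> {-1, 0, 1}" using PiE_mem[OF \<theta>(1) v(1)] .
      moreover have "\<theta> v = \<zeta> v * \<psi> B" using ex[OF v(1)] v(2) B by (simp add: expand_def)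
      ultimately show ?thesis using \<zeta>_cases[OF v(1)] by auto
    qed
    then have "\<psi> \<in> balanced_blocks G S \<rightarrow>\<^sub>E {-1, 0, 1}" by (auto simp: \<psi>_def)
    moreover have "\<theta> = restrict (expand \<psi>) (verts G)"
      using ex PiE_arb[OF \<theta>(1)] by (auto simp: restrict_def fun_eq_iff)
    ultimately show "\<theta> \<in> (\<lambda>\<psi>. restrict (expand \<psi>) (verts G)) ` (balanced_blocks G S \<rightarrow>\<^sub>E {-1, 0, 1})"
      by blast
  qed
qed

end

context gsg_edges
begin

lemma finite_balanced_blocks: "finite (balanced_blocks G S)"
  using finite_verts by (auto simp: balanced_blocks_def)

theorem card_kernel:
  "card {\<theta> \<in> verts G \<rightarrow>\<^sub>E {-1, 0, 1 :: int}. \<forall>e\<in>S. lin G e \<theta> = 0} = 3 ^ num_balanced G S"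
proof -
  obtain \<zeta> where "positive_switcher G S \<zeta>" using ex_positive_switcher by blast
  then interpret gsg_switched G S \<zeta> by unfold_locales
  have "card {\<theta> \<in> verts G \<rightarrow>\<^sub>E {-1, 0, 1 :: int}. \<forall>e\<in>S. lin G e \<theta> = 0} =
      card (balanced_blocks G S \<rightarrow>\<^sub>E {-1, 0, 1 :: int})"
    using bij_betw_same_card[OF kernel_bij] by simp
  also have "\<dots> = 3 ^ card (balanced_blocks G S)"
    using finite_balanced_blocks by (simp add: card_PiE numeral_3_eq_3)
  finally show ?thesis by (simp add: num_balanced_def)
qed

end

section \<open>Contraction\<close>

lemma bij_betw_filter:
  "bij_betw f X Y \<Longrightarrow> (\<And>x. x \<in> X \<Longrightarrow> P x = Q (f x)) \<Longrightarrow> bij_betw f {x \<in> X. P x} {y \<in> Y. Q y}"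
  by (auto simp: bij_betw_def inj_on_def)

text \<open>A power of 3 determines its exponent, so kernel sizes compare block numbers even between
  graphs with different vertex types.\<close>

lemma num_balanced_eqI:
  assumes "gsg_edges G S" "gsg_edges H T"
    "card {\<theta> \<in> verts G \<rightarrow>\<^sub>E {-1, 0, 1 :: int}. \<forall>e\<in>S. lin G e \<theta> = 0} =
     card {\<theta> \<in> verts H \<rightarrow>\<^sub>E {-1, 0, 1 :: int}. \<forall>e\<in>T. lin H e \<theta> = 0}"
  shows "num_balanced G S = num_balanced H T"
  using assms(3) gsg_edges.card_kernel[OF assms(1)] gsg_edges.card_kernel[OF assms(2)] by simp

section \<open>Effect of switching\<close>

lemma gain_gain_switch: "gain (gain_switch \<theta> G) e = gain G e + lin G e \<theta>"
  by (simp add: gain_switch_def lin_def)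

lemma lin_zero: "lin G e (\<lambda>_. 0) = 0"
proof -
  have "(\<Sum>(v, t)\<leftarrow>xs. of_int t * 0) = 0" for xs
    by (induction xs) auto
  then show ?thesis by (simp add: lin_def)
qed

lemma sign_switch_simps [simp]:
  "verts (sign_switch \<zeta> G) = verts G" "edges (sign_switch \<zeta> G) = edges G"
  "gain (sign_switch \<zeta> G) = gain G" "ends (sign_switch \<zeta> G) e = map (\<lambda>(v, t). (v, \<zeta> v * t)) (ends G e)"
  by (simp_all add: sign_switch_def)

lemma gain_switch_simps [simp]:
  "verts (gain_switch \<theta> G) = verts G" "edges (gain_switch \<theta> G) = edges G"
  "ends (gain_switch \<theta> G) = ends G" "esign (gain_switch \<theta> G) = esign G"
  by (simp_all add: gain_switch_def)

lemma is_gsg_gain_update: "is_gain_signed_graph (G\<lparr>gain := g\<rparr>) = is_gain_signed_graph G"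
  by (simp add: is_gain_signed_graph_def link_or_loop_def half_edge_def loose_edge_def)

lemma lin_gain_update: "lin (G\<lparr>gain := g\<rparr>) e = lin G e"
  by (simp add: lin_def fun_eq_iff)

lemma is_gsg_gain_switch: "is_gain_signed_graph (gain_switch \<theta> G) = is_gain_signed_graph G"
  unfolding gain_switch_def by (rule is_gsg_gain_update)

lemma is_gsg_sign_switch:
  assumes G: "is_gain_signed_graph G" and \<zeta>: "\<And>v. v \<in> verts G \<Longrightarrow> \<zeta> v = 1 \<or> \<zeta> v = -1"
  shows "is_gain_signed_graph (sign_switch \<zeta> G)"
proof -
  let ?G = "sign_switch \<zeta> G"
  have "(link_or_loop ?G e \<or> half_edge ?G e \<or> loose_edge ?G e) \<and>
      (\<forall>(v, t) \<in> set (ends ?G e). v \<in> verts ?G \<and> t \<in> {1, -1}) \<and> esign ?G e \<in> {1, -1} \<and>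
      (link_or_loop ?G e \<longrightarrow> snd (ends ?G e ! 0) * snd (ends ?G e ! 1) = - esign ?G e) \<and>
      (half_edge ?G e \<longrightarrow> esign ?G e = -1) \<and> (loose_edge ?G e \<longrightarrow> esign ?G e = 1)"
    if "e \<in> edges G" for e
    using G that
  proof (cases rule: gsg_edge_cases)
    case (1 v t w s)
    then show ?thesis using \<zeta>[OF 1(2)] \<zeta>[OF 1(3)] that
      by (auto simp: sign_switch_def link_or_loop_def half_edge_def loose_edge_def)
  next
    case (2 v t)
    then show ?thesis using \<zeta>[OF 2(2)] that
      by (auto simp: sign_switch_def link_or_loop_def half_edge_def loose_edge_def)
  next
    case 3
    then show ?thesis using that
      by (auto simp: sign_switch_def link_or_loop_def half_edge_def loose_edge_def)
  qed
  moreover have "e \<in> edges G" if "link_or_loop ?G e \<or> half_edge ?G e \<or> loose_edge ?G e" for e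
    using that by (auto simp: link_or_loop_def half_edge_def loose_edge_def)
  moreover have "finite (verts G)" "finite (edges G)" using G by (auto simp: is_gain_signed_graph_def)
  ultimately show ?thesis unfolding is_gain_signed_graph_def by simp
qed

lemma lin_sign_switch: "lin (sign_switch \<zeta> G) e \<theta> = lin G e (\<lambda>v. of_int (\<zeta> v) * \<theta> v)"
proof -
  have "(\<Sum>(v, t)\<leftarrow>map (\<lambda>(v, t). (v, \<zeta> v * t)) xs. of_int t * \<theta> v) =
    (\<Sum>(v, t)\<leftarrow>xs. of_int t * (of_int (\<zeta> v) * \<theta> v))" for xs
    by (induction xs) (auto simp: algebra_simps)
  then show ?thesis by (simp add: lin_def)
qed

lemma lin_gain_switch: "lin (gain_switch \<theta> G) e = lin G e"
  by (simp add: lin_def fun_eq_iff)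

lemma walk_sign_switch: "walk (sign_switch \<zeta> (gain_switch \<theta> G)) u W w = walk G u W w"
proof (induction W arbitrary: u)
  case (Cons d W)
  let ?G = "sign_switch \<zeta> (gain_switch \<theta> G)"
  have step: "is_step ?G d = is_step G d"
    by (simp add: is_step_def link_or_loop_def)
  have "tail ?G d = tail G d \<and> head ?G d = head G d" if "is_step G d"
    using that by (auto simp: is_step_def link_or_loop_def tail_def head_def split_beta nth_map)
  then show ?case using step Cons.IH by (cases "is_step G d") simp_all
qed simp

lemma component_of_switch:
  "component_of (sign_switch \<zeta> (gain_switch \<theta> G)) S = component_of G S"
  by (simp add: component_of_def connected_by_def walk_sign_switch fun_eq_iff)

lemma component_edges_switch:
  "component_edges (sign_switch \<zeta> (gain_switch \<theta> G)) S = component_edges G S"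
  by (auto simp: component_edges_def fun_eq_iff image_image split_beta)

text \<open>Multiplication by \<zeta> carries sign potentials of either graph to the other, so
  circles need not be compared.\<close>

lemma sign_balanced_switch:
  assumes G: "gsg_edges G S" and \<zeta>: "\<And>v. v \<in> verts G \<Longrightarrow> \<zeta> v = 1 \<or> \<zeta> v = -1"
  shows "sign_balanced (sign_switch \<zeta> (gain_switch \<theta> G)) S = sign_balanced G S"
proof -
  let ?G = "sign_switch \<zeta> (gain_switch \<theta> G)"
  interpret gsg_edges G S by (rule G)
  have "is_gain_signed_graph ?G"
    by (rule is_gsg_sign_switch) (simp_all add: is_gsg_gain_switch gsg \<zeta>)
  then interpret G': gsg_edges ?G S by unfold_locales (simp_all add: S_edges)
  have e: "e \<in> edges G" if "e \<in> S" for e using that S_edges by blast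
  show ?thesis
    unfolding sign_balanced_iff G'.sign_balanced_iff
  proof safe
    fix \<eta> :: "'a \<Rightarrow> int"
    assume a: "\<forall>v\<in>verts ?G. \<eta> v = 1 \<or> \<eta> v = -1" "\<forall>e\<in>S. lin ?G e \<eta> = 0"
    have "\<zeta> v * \<eta> v = 1 \<or> \<zeta> v * \<eta> v = -1" if "v \<in> verts G" for v
      using \<zeta>[OF that] a(1) that by auto
    then show "\<exists>\<eta> :: 'a \<Rightarrow> int. (\<forall>v\<in>verts G. \<eta> v = 1 \<or> \<eta> v = -1) \<and> (\<forall>e\<in>S. lin G e \<eta> = 0)"
      using a(2) by (intro exI[of _ "\<lambda>v. \<zeta> v * \<eta> v"]) (simp add: lin_sign_switch lin_gain_switch)
  next
    fix \<eta> :: "'a \<Rightarrow> int"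
    assume a: "\<forall>v\<in>verts G. \<eta> v = 1 \<or> \<eta> v = -1" "\<forall>e\<in>S. lin G e \<eta> = 0"
    have z: "\<zeta> v * \<eta> v = 1 \<or> \<zeta> v * \<eta> v = -1" if "v \<in> verts G" for v
      using \<zeta>[OF that] a(1) that by auto
    have "lin ?G e (\<lambda>v. \<zeta> v * \<eta> v) = lin G e \<eta>" if "e \<in> S" for e
      unfolding lin_sign_switch lin_gain_switch
      by (rule lin_cong[OF gsg e[OF that]]) (use \<zeta> in force)
    then show "\<exists>\<eta> :: 'a \<Rightarrow> int. (\<forall>v\<in>verts ?G. \<eta> v = 1 \<or> \<eta> v = -1) \<and> (\<forall>e\<in>S. lin ?G e \<eta> = 0)"
      using a z by (intro exI[of _ "\<lambda>v. \<zeta> v * \<eta> v"]) simp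
  qed
qed

section \<open>The collapsed graph\<close>

context gsg_switched
begin

lemma balanced_blocks_switch:
  "balanced_blocks (sign_switch \<zeta> (gain_switch \<theta> G)) S = balanced_blocks G S"
  using sign_balanced_switch[OF component_edges_gsg \<zeta>_cases]
  by (auto simp: balanced_blocks_def component_of_switch component_edges_switch)

text \<open>With \<theta> = 0 this also covers the hyperfrustrated case, up to erasing the
  gains.\<close>

abbreviation quot :: "('a \<Rightarrow> 'c) \<Rightarrow> ('a set, 'b, 'c) gain_signed_graph" where
  "quot \<theta> \<equiv> collapse (sign_switch \<zeta> (gain_switch \<theta> G)) S"

lemma quot_simps [simp]:
  "verts (quot \<theta>) = balanced_blocks G S" "edges (quot \<theta>) = edges G - S"
  "gain (quot \<theta>) e = gain G e + lin G e \<theta>"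
  by (simp_all add: collapse_def Let_def balanced_blocks_switch gain_gain_switch)

lemma ends_quot [simp]:
  "ends (quot \<theta>) e = map (\<lambda>(v, t). (component_of G S v, \<zeta> v * t))
     (filter (\<lambda>(v, t). component_of G S v \<in> balanced_blocks G S) (ends G e))"
proof -
  have "map (\<lambda>(v, t). (component_of G S v, t)) (filter (\<lambda>(v, t). component_of G S v \<in> balanced_blocks G S)
      (map (\<lambda>(v, t). (v, \<zeta> v * t)) xs)) = map (\<lambda>(v, t). (component_of G S v, \<zeta> v * t))
     (filter (\<lambda>(v, t). component_of G S v \<in> balanced_blocks G S) xs)" for xs
    by (induction xs) auto
  then show ?thesis by (simp only: collapse_def Let_def balanced_blocks_switch component_of_switch
      sign_switch_simps gain_switch_simps gain_signed_graph.select_convs)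
qed

lemma esign_quot:
  "esign (quot \<theta>) e = (if length (ends (quot \<theta>) e) = 2 then esign (sign_switch \<zeta> G) e
     else if length (ends (quot \<theta>) e) = 1 then -1 else 1)"
proof -
  have "esign (sign_switch \<zeta> (gain_switch \<theta> G)) = esign (sign_switch \<zeta> G)"
    by (auto simp: sign_switch_def fun_eq_iff split: list.split)
  then show ?thesis by (simp add: collapse_def Let_def)
qed

lemma is_gsg_quot: "is_gain_signed_graph (quot \<theta>)"
proof -
  have "(link_or_loop (quot \<theta>) e \<or> half_edge (quot \<theta>) e \<or> loose_edge (quot \<theta>) e) \<and>
      (\<forall>(v, t) \<in> set (ends (quot \<theta>) e). v \<in> verts (quot \<theta>) \<and> t \<in> {1, -1}) \<and> esign (quot \<theta>) e \<in> {1, -1} \<and>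
      (link_or_loop (quot \<theta>) e \<longrightarrow> snd (ends (quot \<theta>) e ! 0) * snd (ends (quot \<theta>) e ! 1) = - esign (quot \<theta>) e) \<and>
      (half_edge (quot \<theta>) e \<longrightarrow> esign (quot \<theta>) e = -1) \<and> (loose_edge (quot \<theta>) e \<longrightarrow> esign (quot \<theta>) e = 1)"
    if e: "e \<in> edges G - S" for e
  proof -
    have "e \<in> edges G" using e by blast
    from gsg this show ?thesis
    proof (cases rule: gsg_edge_cases)
      case (1 v t w s)
      have E: "ends (quot \<theta>) e =
          (if component_of G S v \<in> balanced_blocks G S then [(component_of G S v, \<zeta> v * t)] else []) @
          (if component_of G S w \<in> balanced_blocks G S then [(component_of G S w, \<zeta> w * s)] else [])"
        using 1 by simp
      have sg: "esign (sign_switch \<zeta> G) e = \<zeta> v * esign G e * \<zeta> w"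
        using 1 by (simp add: sign_switch_def)
      show ?thesis
        unfolding link_or_loop_def half_edge_def loose_edge_def esign_quot sg E quot_simps(1,2)
        using \<zeta>_cases[OF 1(2)] \<zeta>_cases[OF 1(3)] 1(4,5,6) e
        by (cases "component_of G S v \<in> balanced_blocks G S"; cases "component_of G S w \<in> balanced_blocks G S")
          (simp_all, auto)
    next
      case (2 v t)
      have E: "ends (quot \<theta>) e =
          (if component_of G S v \<in> balanced_blocks G S then [(component_of G S v, \<zeta> v * t)] else [])"
        using 2 by simp
      show ?thesis
        unfolding link_or_loop_def half_edge_def loose_edge_def esign_quot E quot_simps(1,2)
        using \<zeta>_cases[OF 2(2)] 2(3) e
        by (cases "component_of G S v \<in> balanced_blocks G S") (simp_all, auto)
    next
      case 3
      then have E: "ends (quot \<theta>) e = []" by simp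
      show ?thesis
        unfolding link_or_loop_def half_edge_def loose_edge_def esign_quot E quot_simps(1,2)
        using e by simp
    qed
  qed
  moreover have "e \<in> edges G - S"
    if "link_or_loop (quot \<theta>) e \<or> half_edge (quot \<theta>) e \<or> loose_edge (quot \<theta>) e" for e
    using that by (auto simp: link_or_loop_def half_edge_def loose_edge_def)
  moreover have "finite (verts (quot \<theta>))" "finite (edges (quot \<theta>))"
    using finite_balanced_blocks gsg by (auto simp: is_gain_signed_graph_def)
  ultimately show ?thesis unfolding is_gain_signed_graph_def quot_simps(2) by blast
qed

text \<open>Collapsing edge ends is adjoint to expanding potentials: the ends that disappear are
  those where \<open>expand\<close> vanishes, and the switched orientation carries the factor
  \<zeta>. Both comparisons of the contraction with A Un S rest on this identity.\<close>

lemma lin_quot: "lin (quot \<theta>) e \<psi> = lin G e (expand \<psi>)"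
proof -
  have "(\<Sum>(v, t)\<leftarrow>map (\<lambda>(v, t). (component_of G S v, \<zeta> v * t))
     (filter (\<lambda>(v, t). component_of G S v \<in> balanced_blocks G S) xs). of_int t * \<psi> v) =
    (\<Sum>(v, t)\<leftarrow>xs. of_int t * expand \<psi> v)" for xs
    by (induction xs) (auto simp: expand_def algebra_simps)
  then show ?thesis by (simp add: lin_def)
qed

text \<open>The bijection \<open>kernel_bij\<close> for S is cut down on both sides by the equations
  of A, which correspond under \<open>lin_quot\<close>.\<close>

lemma num_balanced_quot:
  assumes A: "A \<subseteq> edges G - S"
  shows "num_balanced (quot \<theta>) A = num_balanced G (A \<union> S)"
proof (rule num_balanced_eqI)
  show "gsg_edges G (A \<union> S)" using gsg S_edges A by unfold_locales auto
  show "gsg_edges (quot \<theta>) A" using is_gsg_quot A by unfold_locales auto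
  let ?f = "\<lambda>\<psi>. restrict (expand \<psi>) (verts G)"
  have "lin G e (?f \<psi>) = lin (quot \<theta>) e \<psi>" if "e \<in> A" for e and \<psi> :: "'a set \<Rightarrow> int"
    unfolding lin_quot using that A by (intro lin_cong[OF gsg]) auto
  then have bij: "bij_betw ?f {\<psi> \<in> verts (quot \<theta>) \<rightarrow>\<^sub>E {-1, 0, 1 :: int}. \<forall>e\<in>A. lin (quot \<theta>) e \<psi> = 0}
    {\<chi> \<in> {\<chi> \<in> verts G \<rightarrow>\<^sub>E {-1, 0, 1}. \<forall>e\<in>S. lin G e \<chi> = 0}. \<forall>e\<in>A. lin G e \<chi> = 0}"
    unfolding quot_simps(1) by (intro bij_betw_filter[OF kernel_bij]) simp
  have eq: "{\<chi> \<in> {\<chi> \<in> verts G \<rightarrow>\<^sub>E {-1, 0, 1}. \<forall>e\<in>S. lin G e \<chi> = 0}. \<forall>e\<in>A. lin G e \<chi> = 0} =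
    {\<chi> \<in> verts G \<rightarrow>\<^sub>E {-1, 0, 1 :: int}. \<forall>e\<in>A \<union> S. lin G e \<chi> = 0}" by auto
  show "card {\<psi> \<in> verts (quot \<theta>) \<rightarrow>\<^sub>E {-1, 0, 1 :: int}. \<forall>e\<in>A. lin (quot \<theta>) e \<psi> = 0} =
    card {\<chi> \<in> verts G \<rightarrow>\<^sub>E {-1, 0, 1 :: int}. \<forall>e\<in>A \<union> S. lin G e \<chi> = 0}"
    using bij_betw_same_card[OF bij] unfolding eq by simp
qed

text \<open>\<theta> is a particular solution for S, so on the vertices the solutions for S are
  exactly \<theta> plus an expanded \<psi>. The gains of the quotient already contain the \<theta>
  part, leaving an equation for \<psi>.\<close>

lemma hyperbalanced_quot:
  assumes two: "(2::'c) \<noteq> 0" and A: "A \<subseteq> edges G - S" and neutral: "neutral_switcher G S \<theta>"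
  shows "hyperbalanced (quot \<theta>) A \<longleftrightarrow> hyperbalanced G (A \<union> S)"
proof -
  interpret AS: gsg_edges G "A \<union> S" using gsg S_edges A by unfold_locales auto
  interpret Q: gsg_edges "quot \<theta>" A using is_gsg_quot A by unfold_locales auto
  have \<theta>: "gain G e + lin G e \<theta> = 0" if "e \<in> S" for e
    using neutral that by (simp add: neutral_switcher_def gain_gain_switch)
  show ?thesis
    unfolding AS.hyperbalanced_iff_potential[OF two] Q.hyperbalanced_iff_potential[OF two]
  proof
    assume "\<exists>\<psi>. \<forall>e\<in>A. gain (quot \<theta>) e + lin (quot \<theta>) e \<psi> = 0"
    then obtain \<psi> :: "'a set \<Rightarrow> 'c" where \<psi>: "\<forall>e\<in>A. gain (quot \<theta>) e + lin (quot \<theta>) e \<psi> = 0" by blast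
    have "gain G e + lin G e (\<lambda>v. \<theta> v + expand \<psi> v) = 0" if "e \<in> A \<union> S" for e
    proof (cases "e \<in> S")
      case True
      then show ?thesis using \<theta> lin_expand_S[OF True, of \<psi>] by (simp add: lin_add)
    next
      case False
      then show ?thesis using \<psi> that unfolding lin_quot quot_simps(3) by (auto simp: lin_add add.assoc)
    qed
    then show "\<exists>\<chi>. \<forall>e\<in>A \<union> S. gain G e + lin G e \<chi> = 0" by blast
  next
    assume "\<exists>\<chi>. \<forall>e\<in>A \<union> S. gain G e + lin G e \<chi> = 0"
    then obtain \<chi> :: "'a \<Rightarrow> 'c" where \<chi>: "\<And>e. e \<in> A \<union> S \<Longrightarrow> gain G e + lin G e \<chi> = 0" by blast
    define \<delta> where "\<delta> v = \<chi> v - \<theta> v" for v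
    have split: "lin G e \<chi> = lin G e \<theta> + lin G e \<delta>" for e
      using lin_add[of G e \<theta> \<delta>] by (simp add: \<delta>_def)
    have "lin G e \<delta> = 0" if "e \<in> S" for e
      using \<chi>[of e] \<theta>[OF that] that by (simp add: split add.assoc[symmetric])
    then obtain \<psi> where \<psi>: "\<And>v. v \<in> verts G \<Longrightarrow> expand \<psi> v = \<delta> v"
      using kernel_expand[OF two] by blast
    have "gain (quot \<theta>) e + lin (quot \<theta>) e \<psi> = 0" if "e \<in> A" for e
    proof -
      have "lin G e (expand \<psi>) = lin G e \<delta>" using that A \<psi> by (intro lin_cong[OF gsg]) auto
      then show ?thesis using \<chi>[of e] that unfolding lin_quot quot_simps(3) by (simp add: split add.assoc)
    qed
    then show "\<exists>\<psi>. \<forall>e\<in>A. gain (quot \<theta>) e + lin (quot \<theta>) e \<psi> = 0" by blast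
  qed
qed

end

section \<open>Deletion and contraction of the matroid\<close>

lemma matroid_of_rank_cong:
  "E = E' \<Longrightarrow> (\<And>A. A \<subseteq> E \<Longrightarrow> r A = r' A) \<Longrightarrow> matroid_of_rank E r = matroid_of_rank E' r'"
  by (auto simp: matroid_of_rank_def restrict_def fun_eq_iff)

lemma delete_simps [simp]:
  "verts (delete_edges G S) = verts G" "edges (delete_edges G S) = edges G - S"
  "gain (delete_edges G S) = gain G" "ends (delete_edges G S) = ends G"
  "esign (delete_edges G S) = esign G"
  by (simp_all add: delete_edges_def)

lemma lin_delete: "lin (delete_edges G S) e = lin G e"
  by (simp add: lin_def fun_eq_iff)

lemma is_gsg_delete:
  assumes "is_gain_signed_graph G"
  shows "is_gain_signed_graph (delete_edges G S)"
proof -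
  have "link_or_loop (delete_edges G S) e \<longleftrightarrow> link_or_loop G e \<and> e \<notin> S"
    "half_edge (delete_edges G S) e \<longleftrightarrow> half_edge G e \<and> e \<notin> S"
    "loose_edge (delete_edges G S) e \<longleftrightarrow> loose_edge G e \<and> e \<notin> S" for e
    by (auto simp: link_or_loop_def half_edge_def loose_edge_def)
  then show ?thesis using assms unfolding is_gain_signed_graph_def by (simp, blast)
qed

lemma gain_switch_zero: "gain_switch (\<lambda>_. 0) G = G"
proof -
  have "gain_switch (\<lambda>_. 0) G = G\<lparr>gain := \<lambda>e. gain G e + lin G e (\<lambda>_. 0)\<rparr>"
    by (simp only: gain_switch_def lin_def)
  then show ?thesis by (simp add: lin_zero)
qed

context gsg_edges
begin

lemma gain_matroid_delete:
  assumes two: "(2::'k) \<noteq> 0"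
  shows "gain_matroid (delete_edges G S) = matroid_delete (gain_matroid G) S"
proof -
  have "num_balanced (delete_edges G S) A = num_balanced G A \<and>
      hyperbalanced (delete_edges G S) A = hyperbalanced G A"
    if A: "A \<subseteq> edges G - S" for A
  proof -
    interpret D: gsg_edges "delete_edges G S" A
      using is_gsg_delete[OF gsg] A by unfold_locales simp_all
    interpret A: gsg_edges G A using gsg A by unfold_locales auto
    show ?thesis
      using num_balanced_eqI[OF D.gsg_edges_axioms A.gsg_edges_axioms]
        D.hyperbalanced_iff_potential[OF two] A.hyperbalanced_iff_potential[OF two]
      by (simp add: lin_delete)
  qed
  then show ?thesis
    unfolding gain_matroid_def matroid_delete_def
    by (intro matroid_of_rank_cong) (auto simp: matroid_of_rank_def)
qed

lemma ex_contraction: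
  assumes two: "(2::'k) \<noteq> 0"
  shows "\<exists>H. is_contraction G S H"
proof -
  obtain \<zeta> where "positive_switcher G S \<zeta>" using ex_positive_switcher by blast
  moreover have "\<exists>\<theta>. neutral_switcher G S \<theta>" if "hyperbalanced G S"
    using that unfolding hyperbalanced_iff_potential[OF two] neutral_switcher_def gain_gain_switch .
  ultimately show ?thesis unfolding is_contraction_def by (cases "hyperbalanced G S") auto
qed

text \<open>The contraction has b(S) vertices, so its vertex and block terms give b(S) - b(A Un S),
  as does the difference of ranks in G. What remains is to match \<delta>(A) in \<open>H\<close>
  with \<delta>(A Un S) - \<delta>(S) in \<open>G\<close>.\<close>

lemma gain_matroid_contract:
  assumes two: "(2::'k) \<noteq> 0" and H: "is_contraction G S H"
  shows "gain_matroid H = matroid_contract (gain_matroid G) S"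
proof -
  obtain \<zeta> where \<zeta>: "positive_switcher G S \<zeta>" and H: "if hyperbalanced G S
         then \<exists>\<theta>. neutral_switcher G S \<theta> \<and> H = collapse (sign_switch \<zeta> (gain_switch \<theta> G)) S
         else H = (collapse (sign_switch \<zeta> G) S)\<lparr>gain := (\<lambda>_. 0)\<rparr>"
    using H unfolding is_contraction_def by blast
  interpret gsg_switched G S \<zeta> using \<zeta> by unfold_locales
  have key: "verts H = balanced_blocks G S \<and> edges H = edges G - S \<and>
    (\<forall>A\<subseteq>edges G - S. num_balanced H A = num_balanced G (A \<union> S) \<and>
      (if hyperbalanced G S then hyperbalanced H A = hyperbalanced G (A \<union> S) else hyperbalanced H A))"
  proof (cases "hyperbalanced G S")
    case True
    then obtain \<theta> where "neutral_switcher G S \<theta>" "H = quot \<theta>" using H by auto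
    then show ?thesis using True num_balanced_quot hyperbalanced_quot[OF two] by simp
  next
    case False
    then have H0: "H = (quot (\<lambda>_. 0))\<lparr>gain := (\<lambda>_. 0)\<rparr>" using H by (simp add: gain_switch_zero)
    have gsgH: "is_gain_signed_graph H" unfolding H0 is_gsg_gain_update by (rule is_gsg_quot)
    have VE: "verts H = verts (quot (\<lambda>_. 0))" "edges H = edges (quot (\<lambda>_. 0))" by (simp_all add: H0)
    have linH: "lin H e = lin (quot (\<lambda>_. 0)) e" for e
      unfolding H0 by (rule lin_gain_update)
    have "num_balanced H A = num_balanced G (A \<union> S) \<and> hyperbalanced H A" if A: "A \<subseteq> edges G - S" for A
    proof
      interpret H: gsg_edges H A using gsgH A by unfold_locales (simp_all add: VE)
      interpret Q: gsg_edges "quot (\<lambda>_. 0)" A using is_gsg_quot A by unfold_locales auto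
      have "num_balanced H A = num_balanced (quot (\<lambda>_. 0)) A"
        by (rule num_balanced_eqI[OF H.gsg_edges_axioms Q.gsg_edges_axioms]) (simp only: VE linH)
      then show "num_balanced H A = num_balanced G (A \<union> S)" using num_balanced_quot[OF A] by simp
      have "gain H e + lin H e (\<lambda>_. 0) = 0" for e
        by (simp add: H0 lin_zero)
      then show "hyperbalanced H A" unfolding H.hyperbalanced_iff_potential[OF two] by blast
    qed
    then show ?thesis using False VE by simp
  qed
  \<comment> \<open>Hyperfrustration passes to supersets, so here \<delta>(A Un S) - \<delta>(S) = 1
    - 1, in agreement with a hyperbalanced contraction.\<close>
  have hyp: "\<not> hyperbalanced G (A \<union> S)" if "\<not> hyperbalanced G S" for A
    using that unfolding hyperbalanced_def by blast
  have "int (card (verts H)) = int (num_balanced G S)" using key by (simp add: num_balanced_def)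
  then show ?thesis
    unfolding gain_matroid_def matroid_contract_def
    using key hyp S_edges
    by (intro matroid_of_rank_cong) (auto simp: matroid_of_rank_def restrict_def)
qed

end

text \<open>If 2 = 0, the characteristic divides 2, and the value 1 is impossible in a
  field.\<close>

lemma two_neq_zero: "CHAR('k::field) \<noteq> 2 \<Longrightarrow> (2::'k) \<noteq> 0"
proof
  assume c: "CHAR('k) \<noteq> 2" and "(2::'k) = 0"
  then have "(of_nat 2 :: 'k) = 0" by simp
  then have "CHAR('k) dvd 2" by (simp only: of_nat_eq_0_iff_char_dvd)
  then have "CHAR('k) \<le> 2" "CHAR('k) \<noteq> 0"
    using dvd_imp_le[of "CHAR('k)" 2] by (auto intro!: Nat.gr0I)
  then have "CHAR('k) = 1" using c by linarith
  then show False using CHAR_not_1 by simp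
qed

text \<open>The contraction depends on the chosen switchers. Besides the identity for every
  admissible choice, the existence of one is asserted, so that the identity is not vacuous.\<close>

theorem theorem9p6:
  fixes \<Upsilon> :: "('v, 'e, 'k::field) gain_signed_graph" and S :: "'e set"
  assumes "CHAR('k) \<noteq> 2"
    and "is_gain_signed_graph \<Upsilon>"
    and "S \<subseteq> edges \<Upsilon>"
  shows "gain_matroid (delete_edges \<Upsilon> S) = matroid_delete (gain_matroid \<Upsilon>) S \<and>
    (\<exists>H. is_contraction \<Upsilon> S H) \<and>
    (\<forall>H. is_contraction \<Upsilon> S H \<longrightarrow>
       gain_matroid H = matroid_contract (gain_matroid \<Upsilon>) S)"
proof -
  interpret gsg_edges \<Upsilon> S using assms by unfold_locales
  note two = two_neq_zero[OF assms(1)]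
  show ?thesis
    using gain_matroid_delete[OF two] ex_contraction[OF two] gain_matroid_contract[OF two] by blast
qed

end
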